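(* Let $\kappa_0,\kappa_1,\kappa_2>0$ and $d^\infty>0$, and consider the planar system $$\dot x=v,\qquad \dot v=-\kappa_0\Big(\frac{x}{|x|}\Big)^2v-\kappa_1\Big(\frac{x}{|x|}\Big)^2v-\kappa_2\big(|x|-d^\infty\big)\frac{x}{|x|},$$ i.e. $\ddot x=-(\kappa_0+\kappa_1)\dot x-\kappa_2x+\kappa_2d^\infty$ for $x>0$ and $\ddot x=-(\kappa_0+\kappa_1)\dot x-\kappa_2x-\kappa_2d^\infty$ for $x<0$, with initial data $(x(0),v(0))=(x^0,v^0)\ne(0,0)$. Then: (1) the Cauchy problem admits a unique global (i.e. on $[0,\infty)$) Filippov solution $(x,v)$ if and only if the solution satisfies $(x(t),v(t))\ne(0,0)$ for all $t\ge0$; otherwise (if the solution reaches $(0,0)$ at some time) there are infinitely many Filippov solutions; (2) if $(x,v)$ is a Filippov solution with $(x(t),v(t))\ne(0,0)$ for all $t\ge0$, then $\lim_{t\to\infty}|x(t)|=d^\infty$.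
   Context: This system is the relative dynamics $x=x_1-x_2$, $v=v_1-v_2$ of the two-particle Cucker–Smale model with bonding force on the real line with communication weight $\psi\equiv1$ and desired distance $d^\infty=d^\infty_{12}$. Filippov solutions: for a possibly discontinuous vector field $Z:\mathbb{R}^n\to\mathbb{R}^n$, define the set-valued map $F[Z](z):=\bigcap_{\delta>0}\bigcap_{|S|=0}\overline{\mathrm{co}}\{Z(B_\delta(z)\setminus S)\}$, where $\overline{\mathrm{co}}$ is the closed convex hull and the second intersection is over all Lebesgue-null sets $S$. An absolutely continuous $z:[0,T]\to\mathbb{R}^n$ (or on $[0,\infty)$, absolutely continuous on each compact subinterval) is a Filippov solution of $\dot z=Z(z)$ if $\dot z(t)\in F[Z](z(t))$ for almost every $t$. Here $n=2$, $z=(x,v)$, and $Z$ is the right-hand side above (defined arbitrarily on the null set $\{x=0\}$). *)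

theory Defs
  imports "HOL-Analysis.Analysis"
begin

definition abs_continuous_on :: "real \<Rightarrow> real \<Rightarrow> (real \<Rightarrow> 'a::real_normed_vector) \<Rightarrow> bool" where
  "abs_continuous_on s t f \<longleftrightarrow>
     (\<forall>\<epsilon>>0. \<exists>\<delta>>0. \<forall>(n::nat) (a::nat \<Rightarrow> real) (b::nat \<Rightarrow> real).
        (\<forall>i<n. s \<le> a i \<and> a i \<le> b i \<and> b i \<le> t) \<and>
        (\<forall>i<n. \<forall>j<n. i \<noteq> j \<longrightarrow> b i \<le> a j \<or> b j \<le> a i) \<and>
        (\<Sum>i<n. b i - a i) < \<delta>
        \<longrightarrow> (\<Sum>i<n. norm (f (b i) - f (a i))) < \<epsilon>)"

definition filippov_set :: "('a::euclidean_space \<Rightarrow> 'a) \<Rightarrow> 'a \<Rightarrow> 'a set" where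
  "filippov_set Z z =
     (\<Inter>\<delta>\<in>{\<delta>::real. \<delta> > 0}. \<Inter>S\<in>null_sets lebesgue.
        closure (convex hull (Z ` (ball z \<delta> - S))))"

definition filippov_solution :: "('a::euclidean_space \<Rightarrow> 'a) \<Rightarrow> (real \<Rightarrow> 'a) \<Rightarrow> bool" where
  "filippov_solution Z z \<longleftrightarrow>
     (\<forall>T\<ge>0. abs_continuous_on 0 T z) \<and>
     (AE t in lebesgue. t \<ge> 0 \<longrightarrow>
        (\<exists>d. (z has_vector_derivative d) (at t) \<and> d \<in> filippov_set Z (z t)))"

end

theory Submission
  imports Defs
begin

text \<open>
  Write \<open>a = \<kappa>0 + \<kappa>1\<close>, \<open>k = \<kappa>2\<close>, \<open>D = dinf\<close>. The Filippov set is
  \<open>(v, - a v - k x + k D u)\<close> with \<open>u = sgn x\<close> off the line \<open>x = 0\<close> and \<open>u \<in> [-1, 1]\<close> arbitrary on it.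
  Away from the origin a solution meets this line with \<open>v \<noteq> 0\<close>, so it crosses at once and then obeys
  one of the two linear equations, which yields forward uniqueness. From the origin a solution may
  wait for an arbitrary time before leaving, which yields infinitely many solutions.
  Existence comes from gluing linear flows: if \<open>\<bar>v\<bar> \<le> V\<close>, then a flow that starts on the line
  needs at least the time \<open>D / V\<close> to return to it, since \<open>x\<close> increases as long as \<open>x < D\<close>.

  For the limit, the energy \<open>v\<^sup>2 / 2 + k / 2 * (\<bar>x\<bar> - D)\<^sup>2\<close> decays at rate \<open>a v\<^sup>2\<close> along solutions that avoid the
  origin. As \<open>v\<close> is Lipschitz, this forces \<open>v \<rightarrow> 0\<close>. A slow trajectory cannot cross \<open>x = 0\<close>: it
  would be accelerated there by about \<open>k D\<close>. Hence \<open>x\<close> has no zeros at late times, and the mean value theorem for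
  \<open>v\<close> on unit intervals gives \<open>\<bar>x\<bar> \<rightarrow> D\<close>.
\<close>

subsection \<open>Absolutely continuous functions\<close>

text \<open>
  A Cousin-type covering: tags in the exceptional null set get intervals inside an open set of small
  measure, where absolute continuity bounds the increments; at all other tags the derivative bounds them.
\<close>

lemma abs_continuous_on_deriv_nonpos_le:
  fixes f :: "real \<Rightarrow> real"
  assumes ac: "abs_continuous_on s t f" and st: "s \<le> t"
    and der: "AE x in lebesgue. s < x \<and> x < t \<longrightarrow> (\<exists>d\<le>0. (f has_real_derivative d) (at x))"
  shows "f t \<le> f s"
proof (rule field_le_epsilon)
  fix e :: real assume e: "e > 0"
  \<comment> \<open>Slope allowance for tags outside the exceptional set: their intervals add up to
    at most \<open>c * (t - s)\<close>, which is at most \<open>e / 2\<close>. The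
    \<open>+ 1\<close> keeps the denominator positive when \<open>s = t\<close>.\<close>
  define c where "c = e / (2 * (t - s + 1))"
  have c: "c > 0" using e st by (simp add: c_def)
  have cts: "c * (t - s) \<le> e / 2"
  proof -
    have "c * (t - s) \<le> c * (t - s + 1)" using c by simp
    also have "\<dots> = e / 2" using st by (simp add: c_def field_simps)
    finally show ?thesis .
  qed
  have "\<exists>\<delta>>0. \<forall>(n::nat) a b.
        (\<forall>i<n. s \<le> a i \<and> a i \<le> b i \<and> b i \<le> t) \<and>
        (\<forall>i<n. \<forall>j<n. i \<noteq> j \<longrightarrow> b i \<le> a j \<or> b j \<le> a i) \<and>
        (\<Sum>i<n. b i - a i) < \<delta>
        \<longrightarrow> (\<Sum>i<n. norm (f (b i) - f (a i))) < e/2"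
    by (rule ac[unfolded abs_continuous_on_def, THEN spec, THEN mp, OF half_gt_zero[OF e]])
  then obtain \<delta> where \<delta>: "\<delta> > 0" and ac\<delta>: "\<And>(n::nat) a b.
       (\<forall>i<n. s \<le> a i \<and> a i \<le> b i \<and> b i \<le> t) \<Longrightarrow>
       (\<forall>i<n. \<forall>j<n. i \<noteq> j \<longrightarrow> b i \<le> a j \<or> b j \<le> a i) \<Longrightarrow>
       (\<Sum>i<n. b i - a i) < \<delta> \<Longrightarrow> (\<Sum>i<n. norm (f (b i) - f (a i))) < e/2"
    by blast
  \<comment> \<open>The endpoints are put into \<open>N\<close> as well, since the hypothesis gives
    no two-sided derivative there.\<close>
  define N where "N = {x\<in>{s..t}. \<not> (s < x \<and> x < t \<and> (\<exists>d\<le>0. (f has_real_derivative d) (at x)))}"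
  have N_null: "N \<in> null_sets lebesgue"
  proof -
    obtain N' where N': "{x. \<not> (s < x \<and> x < t \<longrightarrow> (\<exists>d\<le>0. (f has_real_derivative d) (at x)))} \<subseteq> N'"
        "N' \<in> null_sets lebesgue"
      using der[unfolded eventually_ae_filter] by auto
    have "N \<subseteq> N' \<union> {s,t}" using N' by (auto simp: N_def less_eq_real_def)
    moreover have "negligible (N' \<union> {s,t})"
      using N' by (simp add: negligible_iff_null_sets[symmetric] negligible_Un)
    ultimately show ?thesis using negligible_subset negligible_iff_null_sets by blast
  qed
  obtain U where U: "open U" "N \<subseteq> U" "U - N \<in> lmeasurable" "emeasure lebesgue (U - N) < ennreal \<delta>"
    using sets_lebesgue_outer_open[of N \<delta>] N_null \<delta> by auto
  have UN: "U = (U - N) \<union> N" using U by auto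
  have Ulm: "U \<in> lmeasurable"
    using U N_null by (metis UN fmeasurable.Un negligible_iff_null_sets negligible_imp_measurable)
  have "emeasure lebesgue U = emeasure lebesgue (U - N)"
    using U N_null by (metis emeasure_Un_null_set fmeasurableD UN)
  then have mU: "measure lebesgue U < \<delta>"
    using U(4) \<delta> Ulm by (metis emeasure_eq_measure2 ennreal_less_iff measure_nonneg)
  \<comment> \<open>Outside \<open>N\<close> only intervals containing the tag \<open>x\<close> are
    considered: the derivative at \<open>x\<close> compares \<open>f w\<close> and
    \<open>f u\<close> with \<open>f x\<close>, and for \<open>u \<le> x \<le> w\<close> the two
    errors add up to exactly \<open>c * (w - u)\<close>.\<close>
  have "\<exists>r>0. (x \<in> N \<longrightarrow> ball x r \<subseteq> U) \<and>
     (x \<in> {s..t} - N \<longrightarrow> (\<forall>u w. u \<le> x \<and> x \<le> w \<and> u \<in> ball x r \<and> w \<in> ball x r \<longrightarrow> f w - f u \<le> c * (w - u)))"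
    for x
  proof (cases "x \<in> N")
    case True then show ?thesis using U by (metis DiffE open_contains_ball subsetD)
  next
    case False
    show ?thesis
    proof (cases "x \<in> {s..t}")
      case True
      then obtain d where d: "d \<le> 0" "(f has_real_derivative d) (at x)"
        using False by (auto simp: N_def)
      obtain r where r: "r > 0" "\<And>y. norm (y - x) < r \<Longrightarrow> norm (f y - f x - d * (y - x)) \<le> c * norm (y - x)"
        using d(2)[unfolded has_field_derivative_def has_derivative_at_alt] c by blast
      have "f w - f u \<le> c * (w - u)" if "u \<le> x" "x \<le> w" "u \<in> ball x r" "w \<in> ball x r" for u w
      proof -
        have "\<bar>f w - f x - d * (w - x)\<bar> \<le> c * (w - x)"
          using r(2)[of w] that by (auto simp: dist_norm norm_minus_commute)
        moreover have "\<bar>f u - f x - d * (u - x)\<bar> \<le> c * (x - u)"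
          using r(2)[of u] that by (auto simp: dist_norm norm_minus_commute)
        moreover have "d * (w - x) \<le> 0" "0 \<le> d * (u - x)"
          using d that by (auto intro: mult_nonpos_nonneg mult_nonpos_nonpos)
        ultimately show ?thesis by (simp add: algebra_simps abs_le_iff)
      qed
      then show ?thesis using r(1) False by blast
    qed (use False in \<open>auto intro: exI[of _ 1]\<close>)
  qed
  then obtain r where r: "\<And>x. r x > 0" "\<And>x. x \<in> N \<Longrightarrow> ball x (r x) \<subseteq> U"
    "\<And>x u w. x \<in> {s..t} - N \<Longrightarrow> u \<le> x \<Longrightarrow> x \<le> w \<Longrightarrow> u \<in> ball x (r x) \<Longrightarrow> w \<in> ball x (r x)
       \<Longrightarrow> f w - f u \<le> c * (w - u)"
    by metis
  obtain p where p: "p tagged_division_of {s..t}" "(\<lambda>x. ball x (r x)) fine p"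
    using fine_division_exists_real[OF gauge_ball_dependent] r(1) by metis
  have finp: "finite p" using p by blast
  have K: "K = {Inf K..Sup K} \<and> Inf K \<le> x \<and> x \<le> Sup K \<and> s \<le> Inf K \<and> Sup K \<le> t \<and> K \<subseteq> ball x (r x)"
    if xK: "(x,K) \<in> p" for x K
  proof -
    obtain u w where uw: "K = {u..w}"
      using tagged_division_ofD(4)[OF p(1) xK] by auto
    moreover have "x \<in> K" "K \<subseteq> {s..t}" using tagged_division_ofD(2,3)[OF p(1) xK] .
    moreover have "K \<subseteq> ball x (r x)" using p(2) xK by (auto simp: fine_def)
    ultimately show ?thesis by auto
  qed
  \<comment> \<open>One-point intervals are left out: they contribute no increment, and disjoint
    interiors order the endpoints of two intervals only if both interiors are nonempty.\<close>
  define A where "A = {(x,K)\<in>p. x \<in> N \<and> Inf K < Sup K}"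
  have Ap: "A \<subseteq> p" by (auto simp: A_def)
  have finA: "finite A" using finp Ap finite_subset by blast
  have I: "(\<Sum>(x,K)\<in>p - A. f (Sup K) - f (Inf K)) \<le> e / 2"
  proof -
    have "(\<Sum>(x,K)\<in>p - A. f (Sup K) - f (Inf K)) \<le> (\<Sum>(x,K)\<in>p - A. c * (Sup K - Inf K))"
    proof (rule sum_mono, clarify)
      fix x K assume xK: "(x,K) \<in> p" "(x,K) \<notin> A"
      note KK = K[OF xK(1)]
      have mem: "Inf K \<in> K" "Sup K \<in> K" using KK by (metis atLeastAtMost_iff order_refl order_trans)+
      show "f (Sup K) - f (Inf K) \<le> c * (Sup K - Inf K)"
      proof (cases "x \<in> N")
        case True
        then have "Inf K = Sup K" using xK KK by (force simp: A_def)
        then show ?thesis by simp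
      next
        case False
        then show ?thesis using KK mem by (intro r(3)[of x]) auto
      qed
    qed
    also have "\<dots> \<le> (\<Sum>(x,K)\<in>p. c * (Sup K - Inf K))"
      using finp c K by (intro sum_mono2) (force intro!: mult_nonneg_nonneg)+
    also have "\<dots> = c * (\<Sum>(x,K)\<in>p. Sup K - Inf K)"
      by (simp add: sum_distrib_left case_prod_unfold)
    also have "\<dots> = c * (t - s)"
      using additive_tagged_division_1[OF st p(1), of "\<lambda>x. x"] by simp
    finally show ?thesis using cts by linarith
  qed
  have disj: "interior K \<inter> interior K' = {}" if "(x,K) \<in> p" "(x',K') \<in> p" "(x,K) \<noteq> (x',K')" for x K x' K'
    using tagged_division_ofD(5)[OF p(1) that(1,2)] that(3) by auto
  have intK: "interior K = {Inf K<..<Sup K}" if "(x,K) \<in> p" for x K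
    using K[OF that] by (metis interior_atLeastAtMost_real)
  \<comment> \<open>The pieces in \<open>A\<close> are numbered, because absolute continuity is
    phrased for finite sequences of intervals.\<close>
  obtain h where h: "bij_betw h {0..<card A} A"
    using ex_bij_betw_nat_finite[OF finA] by blast
  define n where "n = card A"
  have h': "bij_betw h {..<n} A" using h by (simp add: n_def atLeast0LessThan)
  define a where "a i = Inf (snd (h i))" for i
  define b where "b i = Sup (snd (h i))" for i
  have hA: "h i \<in> A" if "i < n" for i using h' that by (auto simp: bij_betw_def)
  have sum_A: "(\<Sum>(x,K)\<in>A. g (Inf K) (Sup K)) = (\<Sum>i<n. g (a i) (b i))" for g :: "real \<Rightarrow> real \<Rightarrow> real"
    using sum.reindex_bij_betw[OF h', of "\<lambda>(x,K). g (Inf K) (Sup K)"]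
    by (simp add: a_def b_def case_prod_unfold)
  have II: "(\<Sum>i<n. norm (f (b i) - f (a i))) < e/2"
  proof (rule ac\<delta>; (intro allI impI)?)
    fix i assume i: "i < n"
    obtain x K where xK: "h i = (x,K)" by fastforce
    then have "(x,K) \<in> p" using hA[OF i] Ap by auto
    then show "s \<le> a i \<and> a i \<le> b i \<and> b i \<le> t" using K[of x K] xK by (auto simp: a_def b_def)
  next
    fix i j assume ij: "i < n" "j < n" "i \<noteq> j"
    obtain x K where xK: "h i = (x,K)" by fastforce
    obtain y L where yL: "h j = (y,L)" by fastforce
    have "h i \<noteq> h j" using h' ij by (auto simp: bij_betw_def inj_on_def)
    moreover have inA: "(x,K) \<in> A" "(y,L) \<in> A" using hA ij xK yL by metis+
    ultimately have "{Inf K<..<Sup K} \<inter> {Inf L<..<Sup L} = {}"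
      using disj[of x K y L] intK xK yL Ap by (metis subsetD)
    moreover have "Inf K < Sup K" "Inf L < Sup L" using inA by (auto simp: A_def)
    ultimately have "Sup K \<le> Inf L \<or> Sup L \<le> Inf K"
      by (metis Int_greaterThanLessThan greaterThanLessThan_empty_iff max_def min_def linorder_not_le not_less_iff_gr_or_eq)
    then show "b i \<le> a j \<or> b j \<le> a i" by (simp add: a_def b_def xK yL)
  next
    have "(\<Sum>i<n. b i - a i) = (\<Sum>(x,K)\<in>A. Sup K - Inf K)"
      using sum_A[of "\<lambda>u w. w - u"] by simp
    also have "\<dots> = (\<Sum>(x,K)\<in>A. measure lebesgue (interior K))"
    proof (intro sum.cong refl, clarify)
      fix x K assume "(x,K) \<in> A"
      then have "(x,K) \<in> p" "Inf K \<le> Sup K" using Ap by (auto simp: A_def)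
      then show "Sup K - Inf K = measure lebesgue (interior K)"
        using intK by simp
    qed
    \<comment> \<open>Interiors of distinct pieces are disjoint, so the total length is the measure
      of their union. This union lies in \<open>U\<close>, hence has measure below
      \<open>\<delta>\<close>.\<close>
    also have "\<dots> = measure lebesgue (\<Union>(x,K)\<in>A. interior K)"
    proof -
      have "measure lebesgue (\<Union>q\<in>A. interior (snd q)) = (\<Sum>q\<in>A. measure lebesgue (interior (snd q)))"
      proof (rule measure_finite_Union[OF finA])
        show "disjoint_family_on (\<lambda>q. interior (snd q)) A"
          unfolding disjoint_family_on_def using disj Ap
          by (metis prod.collapse subsetD)
        show "emeasure lebesgue (interior (snd q)) \<noteq> \<infinity>" if "q \<in> A" for q
          using that intK[of "fst q" "snd q"] K[of "fst q" "snd q"] Ap by auto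
      qed auto
      then show ?thesis by (simp add: case_prod_unfold)
    qed
    also have "\<dots> \<le> measure lebesgue U"
    proof (rule measure_mono_fmeasurable[OF _ _ Ulm])
      show "(\<Union>(x, K)\<in>A. interior K) \<subseteq> U"
      proof clarify
        fix y x K assume y: "(x,K) \<in> A" "y \<in> interior K"
        then have "y \<in> K" "K \<subseteq> ball x (r x)" "x \<in> N"
          using K[of x K] interior_subset by (auto simp: A_def)
        then show "y \<in> U" using r(2) by blast
      qed
    qed (auto intro!: sets.finite_UN finA simp: case_prod_unfold)
    also have "\<dots> < \<delta>" by (rule mU)
    finally show "(\<Sum>i<n. b i - a i) < \<delta>" .
  qed
  have "f t - f s = (\<Sum>(x,K)\<in>p. f (Sup K) - f (Inf K))"
    using additive_tagged_division_1[OF st p(1), of f] by simp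
  also have "\<dots> = (\<Sum>(x,K)\<in>p - A. f (Sup K) - f (Inf K)) + (\<Sum>(x,K)\<in>A. f (Sup K) - f (Inf K))"
    by (rule sum.subset_diff[OF Ap finp])
  also have "(\<Sum>(x,K)\<in>A. f (Sup K) - f (Inf K)) = (\<Sum>i<n. f (b i) - f (a i))"
    using sum_A[of "\<lambda>u w. f w - f u"] by simp
  also have "\<dots> \<le> (\<Sum>i<n. norm (f (b i) - f (a i)))" by (intro sum_mono) simp
  finally show "f t \<le> f s + e" using I II by linarith
qed

section \<open>Calculus of absolutely continuous functions and recovery of classical
  derivatives\<close>

definition nonoverlapping_family :: "real \<Rightarrow> real \<Rightarrow> nat \<Rightarrow> (nat \<Rightarrow> real) \<Rightarrow> (nat \<Rightarrow> real) \<Rightarrow> bool" where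
  "nonoverlapping_family s t n a b \<longleftrightarrow>
     (\<forall>i<n. s \<le> a i \<and> a i \<le> b i \<and> b i \<le> t) \<and>
     (\<forall>i<n. \<forall>j<n. i \<noteq> j \<longrightarrow> b i \<le> a j \<or> b j \<le> a i)"

lemma abs_continuous_on_altdef:
  "abs_continuous_on s t f \<longleftrightarrow>
     (\<forall>e>0. \<exists>\<delta>>0. \<forall>n a b. nonoverlapping_family s t n a b \<longrightarrow> (\<Sum>i<n. b i - a i) < \<delta> \<longrightarrow>
        (\<Sum>i<n. norm (f (b i) - f (a i))) < e)"
  by (simp only: abs_continuous_on_def nonoverlapping_family_def imp_conjL conj_assoc)

lemma lipschitz_on_imp_abs_continuous_on:
  assumes L: "L-lipschitz_on {s..t} f"
  shows "abs_continuous_on s t f"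
  unfolding abs_continuous_on_altdef
proof (intro allI impI)
  fix e :: real assume e: "e > 0"
  have L0: "L \<ge> 0" using L lipschitz_on_nonneg by blast
  \<comment> \<open>Dividing by \<open>L + 1\<close> instead of \<open>L\<close> covers the
    Lipschitz constant 0.\<close>
  show "\<exists>\<delta>>0. \<forall>n a b. nonoverlapping_family s t n a b \<longrightarrow> (\<Sum>i<n. b i - a i) < \<delta> \<longrightarrow>
      (\<Sum>i<n. norm (f (b i) - f (a i))) < e"
  proof (intro exI[of _ "e / (L + 1)"] conjI allI impI)
    show "e / (L + 1) > 0" using e L0 by simp
    fix n a b assume *: "nonoverlapping_family s t n a b" "(\<Sum>i<n. b i - a i) < e / (L + 1)"
    have ab: "s \<le> a i" "a i \<le> b i" "b i \<le> t" if "i < n" for i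
      using * that by (auto simp: nonoverlapping_family_def)
    have "(\<Sum>i<n. norm (f (b i) - f (a i))) \<le> (\<Sum>i<n. L * (b i - a i))"
    proof (intro sum_mono)
      fix i assume "i \<in> {..<n}"
      then show "norm (f (b i) - f (a i)) \<le> L * (b i - a i)"
        using lipschitz_onD[OF L, of "b i" "a i"] ab[of i] by (auto simp: dist_norm)
    qed
    also have "\<dots> = L * (\<Sum>i<n. b i - a i)" by (simp add: sum_distrib_left)
    also have "\<dots> \<le> (L + 1) * (\<Sum>i<n. b i - a i)"
      using ab by (intro mult_right_mono sum_nonneg) auto
    also have "\<dots> < e" using *(2) L0 by (auto simp: field_simps)
    finally show "(\<Sum>i<n. norm (f (b i) - f (a i))) < e" .
  qed
qed

lemma abs_continuous_on_diff:
  assumes f: "abs_continuous_on s t f" and g: "abs_continuous_on s t g"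
  shows "abs_continuous_on s t (\<lambda>x. f x - g x)"
  unfolding abs_continuous_on_altdef
proof (intro allI impI)
  fix e :: real assume "e > 0"
  then have e: "e / 2 > 0" by simp
  obtain d1 where "d1 > 0" and
    d1: "\<And>n a b. nonoverlapping_family s t n a b \<Longrightarrow> (\<Sum>i<n. b i - a i) < d1
        \<Longrightarrow> (\<Sum>i<n. norm (f (b i) - f (a i))) < e / 2"
    using f e unfolding abs_continuous_on_altdef by blast
  moreover obtain d2 where "d2 > 0" and
    d2: "\<And>n a b. nonoverlapping_family s t n a b \<Longrightarrow> (\<Sum>i<n. b i - a i) < d2
        \<Longrightarrow> (\<Sum>i<n. norm (g (b i) - g (a i))) < e / 2"
    using g e unfolding abs_continuous_on_altdef by blast
  ultimately show "\<exists>\<delta>>0. \<forall>n a b. nonoverlapping_family s t n a b \<longrightarrow> (\<Sum>i<n. b i - a i) < \<delta> \<longrightarrow>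
      (\<Sum>i<n. norm (f (b i) - g (b i) - (f (a i) - g (a i)))) < e"
  proof (intro exI[of _ "min d1 d2"] conjI allI impI)
    fix n a b assume *: "nonoverlapping_family s t n a b" "(\<Sum>i<n. b i - a i) < min d1 d2"
    have "(\<Sum>i<n. norm (f (b i) - g (b i) - (f (a i) - g (a i))))
        \<le> (\<Sum>i<n. norm (f (b i) - f (a i)) + norm (g (b i) - g (a i)))"
    proof (intro sum_mono)
      fix i
      have "f (b i) - g (b i) - (f (a i) - g (a i)) = (f (b i) - f (a i)) - (g (b i) - g (a i))" by simp
      then show "norm (f (b i) - g (b i) - (f (a i) - g (a i))) \<le> norm (f (b i) - f (a i)) + norm (g (b i) - g (a i))"
        by (metis norm_triangle_ineq4)
    qed
    also have "\<dots> = (\<Sum>i<n. norm (f (b i) - f (a i))) + (\<Sum>i<n. norm (g (b i) - g (a i)))"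
      by (rule sum.distrib)
    also have "\<dots> < e" using d1[OF *(1)] d2[OF *(1)] *(2) by auto
    finally show "(\<Sum>i<n. norm (f (b i) - g (b i) - (f (a i) - g (a i)))) < e" .
  qed auto
qed

lemma abs_continuous_on_bounded_linear:
  assumes h: "bounded_linear h" and f: "abs_continuous_on s t f"
  shows "abs_continuous_on s t (\<lambda>x. h (f x))"
  unfolding abs_continuous_on_altdef
proof (intro allI impI)
  fix e :: real assume e: "e > 0"
  obtain B where B: "B > 0" "\<And>x. norm (h x) \<le> norm x * B"
    using bounded_linear.pos_bounded[OF h] by blast
  have "e / B > 0" using e B by simp
  then obtain d where "d > 0" and
    d: "\<And>n a b. nonoverlapping_family s t n a b \<Longrightarrow> (\<Sum>i<n. b i - a i) < d
        \<Longrightarrow> (\<Sum>i<n. norm (f (b i) - f (a i))) < e / B"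
    using f unfolding abs_continuous_on_altdef by blast
  then show "\<exists>\<delta>>0. \<forall>n a b. nonoverlapping_family s t n a b \<longrightarrow> (\<Sum>i<n. b i - a i) < \<delta> \<longrightarrow>
      (\<Sum>i<n. norm (h (f (b i)) - h (f (a i)))) < e"
  proof (intro exI[of _ d] conjI allI impI)
    fix n a b assume *: "nonoverlapping_family s t n a b" "(\<Sum>i<n. b i - a i) < d"
    have "(\<Sum>i<n. norm (h (f (b i)) - h (f (a i)))) \<le> (\<Sum>i<n. norm (f (b i) - f (a i)) * B)"
      using B(2) by (intro sum_mono) (simp add: linear_diff[OF bounded_linear.linear[OF h], symmetric])
    also have "\<dots> = (\<Sum>i<n. norm (f (b i) - f (a i))) * B" by (simp add: sum_distrib_right)
    also have "\<dots> < e" using d[OF *] B(1) by (simp add: field_simps)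
    finally show "(\<Sum>i<n. norm (h (f (b i)) - h (f (a i)))) < e" .
  qed
qed

lemma abs_continuous_on_subinterval:
  assumes "abs_continuous_on s t f" "s \<le> s'" "t' \<le> t"
  shows "abs_continuous_on s' t' f"
proof -
  have *: "nonoverlapping_family s t n a b" if "nonoverlapping_family s' t' n a b" for n a b
    using that assms(2,3) unfolding nonoverlapping_family_def by force
  show ?thesis
    unfolding abs_continuous_on_altdef
  proof (intro allI impI)
    fix e :: real assume "e > 0"
    then obtain d where "d > 0" "\<And>n a b. nonoverlapping_family s t n a b \<Longrightarrow> (\<Sum>i<n. b i - a i) < d
        \<Longrightarrow> (\<Sum>i<n. norm (f (b i) - f (a i))) < e"
      using assms(1) unfolding abs_continuous_on_altdef by blast
    then show "\<exists>\<delta>>0. \<forall>n a b. nonoverlapping_family s' t' n a b \<longrightarrow> (\<Sum>i<n. b i - a i) < \<delta> \<longrightarrow>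
        (\<Sum>i<n. norm (f (b i) - f (a i))) < e"
      using * by (intro exI[of _ d]) simp
  qed
qed

lemma abs_continuous_on_imp_continuous_on:
  assumes "abs_continuous_on s t f"
  shows "continuous_on {s..t} f"
proof (rule continuous_onI)
  fix x e :: real assume x: "x \<in> {s..t}" and e: "e > 0"
  obtain d where d: "d > 0" and
    d1: "\<And>n a b. nonoverlapping_family s t n a b \<Longrightarrow> (\<Sum>i<n. b i - a i) < d
        \<Longrightarrow> (\<Sum>i<n. norm (f (b i) - f (a i))) < e"
    using assms e unfolding abs_continuous_on_altdef by blast
  have "dist (f y) (f x) \<le> e" if "y \<in> {s..t}" "dist y x < d" for y
  proof (cases "x \<le> y")
    case True then show ?thesis
      using d1[of 1 "\<lambda>_. x" "\<lambda>_. y"] that x by (auto simp: dist_norm nonoverlapping_family_def)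
  next
    case False then show ?thesis
      using d1[of 1 "\<lambda>_. y" "\<lambda>_. x"] that x
      by (auto simp: dist_norm norm_minus_commute nonoverlapping_family_def)
  qed
  then show "\<exists>d>0. \<forall>x'\<in>{s..t}. dist x' x < d \<longrightarrow> dist (f x') (f x) \<le> e"
    using d by blast
qed

lemma has_vector_derivative_bounded_imp_lipschitz_on:
  fixes f :: "real \<Rightarrow> 'a::real_normed_vector"
  assumes "\<And>x. x \<in> {s..t} \<Longrightarrow> (f has_vector_derivative g x) (at x within {s..t})"
    and B: "\<And>x. x \<in> {s..t} \<Longrightarrow> norm (g x) \<le> B" "B \<ge> 0"
  shows "B-lipschitz_on {s..t} f"
proof (rule lipschitz_onI)
  show "dist (f x) (f y) \<le> B * dist x y" if "x \<in> {s..t}" "y \<in> {s..t}" for x y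
    unfolding dist_norm
  proof (rule differentiable_bound[of "{s..t}" f "\<lambda>x h. h *\<^sub>R g x"])
    show "onorm (\<lambda>h. h *\<^sub>R g x) \<le> B" if "x \<in> {s..t}" for x
      using mult_right_mono[OF B(1)[OF that] abs_ge_zero] by (intro onorm_le) (simp add: mult.commute)
  qed (use assms that in \<open>auto simp: has_vector_derivative_def\<close>)
qed (rule B)

lemma continuous_deriv_imp_lipschitz_on:
  fixes f :: "real \<Rightarrow> 'a::real_normed_vector"
  assumes "\<And>x. x \<in> {s..t} \<Longrightarrow> (f has_vector_derivative g x) (at x within {s..t})"
    and g: "continuous_on {s..t} g"
  obtains B where "B-lipschitz_on {s..t} f"
proof -
  have "bounded (g ` {s..t})" using g compact_continuous_image compact_imp_bounded compact_Icc by blast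
  then obtain B where "\<And>x. x \<in> {s..t} \<Longrightarrow> norm (g x) \<le> B"
    unfolding bounded_iff by blast
  then have "(max B 0)-lipschitz_on {s..t} f"
    using assms(1) by (intro has_vector_derivative_bounded_imp_lipschitz_on[of s t f g]) (auto intro: max.coboundedI1)
  then show ?thesis using that by blast
qed

text \<open>The difference between \<open>f\<close> and the integral of \<open>g\<close> has
  derivative 0 almost everywhere. Monotonicity applied to it and to its negative makes it constant.
  This turns almost-everywhere information into a classical derivative at every point, one-sided at
  the endpoints.\<close>

lemma abs_continuous_on_AE_deriv_continuous:
  fixes f :: "real \<Rightarrow> real"
  assumes ac: "abs_continuous_on s t f" and g: "continuous_on {s..t} g"
    and der: "AE x in lebesgue. s < x \<and> x < t \<longrightarrow> (f has_real_derivative g x) (at x)"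
    and x: "x \<in> {s..t}"
  shows "(f has_real_derivative g x) (at x within {s..t})"
proof -
  define I where "I x = integral {s..x} g" for x
  have I: "(I has_real_derivative g x) (at x within {s..t})" if "x \<in> {s..t}" for x
    using integral_has_vector_derivative[OF g that]
    unfolding I_def has_real_derivative_iff_has_vector_derivative .
  have I': "(I has_real_derivative g x) (at x)" if "s < x \<and> x < t" for x
    using I[of x] that at_within_interior[of x "{s..t}"] by auto
  obtain L where L: "L-lipschitz_on {s..t} I"
    using continuous_deriv_imp_lipschitz_on[of s t I g] I g
    by (auto simp: has_real_derivative_iff_has_vector_derivative)
  then have acI: "abs_continuous_on s t I" by (rule lipschitz_on_imp_abs_continuous_on)
  have eq: "f y = f s + I y" if y: "y \<in> {s..t}" for y
  proof -
    have I0: "I s = 0" by (simp add: I_def)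
    have sub: "AE x in lebesgue. s < x \<and> x < y \<longrightarrow> (f has_real_derivative g x) (at x)"
      using der by eventually_elim (use y in auto)
    have "AE x in lebesgue. s < x \<and> x < y \<longrightarrow> (\<exists>d\<le>0. ((\<lambda>x. f x - I x) has_real_derivative d) (at x))"
      using sub
    proof eventually_elim
      case (elim x)
      then show ?case using I'[of x] y by (intro impI exI[of _ 0]) (auto intro!: derivative_eq_intros)
    qed
    then have "f y - I y \<le> f s - I s"
      using y by (intro abs_continuous_on_deriv_nonpos_le[of s y "\<lambda>x. f x - I x"] abs_continuous_on_diff
          abs_continuous_on_subinterval[OF ac] abs_continuous_on_subinterval[OF acI]) auto
    moreover have "AE x in lebesgue. s < x \<and> x < y \<longrightarrow> (\<exists>d\<le>0. ((\<lambda>x. I x - f x) has_real_derivative d) (at x))"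
      using sub
    proof eventually_elim
      case (elim x)
      then show ?case using I'[of x] y by (intro impI exI[of _ 0]) (auto intro!: derivative_eq_intros)
    qed
    then have "I y - f y \<le> I s - f s"
      using y by (intro abs_continuous_on_deriv_nonpos_le[of s y "\<lambda>x. I x - f x"] abs_continuous_on_diff
          abs_continuous_on_subinterval[OF ac] abs_continuous_on_subinterval[OF acI]) auto
    ultimately show ?thesis using I0 by simp
  qed
  have "((\<lambda>y. f s + I y) has_real_derivative g x) (at x within {s..t})"
    using I[OF x] by (auto intro!: derivative_eq_intros)
  then show ?thesis
    using has_vector_derivative_transform[OF x, of f "\<lambda>y. f s + I y" "g x"] eq
    unfolding has_real_derivative_iff_has_vector_derivative by blast
qed

subsection \<open>The Filippov set of the bonding system\<close>

text \<open>A nonempty open set contains a ball of positive measure, so deleting a null set cannot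
  exhaust it. This supplies sample points of the vector field after an arbitrary null set has been
  removed.\<close>

lemma negligible_imp_open_diff_nonempty:
  fixes W :: "'a::euclidean_space set"
  assumes "open W" "W \<noteq> {}" "negligible S"
  shows "W - S \<noteq> {}"
proof
  assume "W - S = {}"
  then have "W \<subseteq> S" by blast
  then have "negligible W" using assms(3) negligible_subset by blast
  moreover obtain x e where "e > 0" "ball x e \<subseteq> W"
    using assms(1,2) open_contains_ball by blast
  ultimately have "negligible (ball x e)" using negligible_subset by blast
  then have "measure lebesgue (ball x e) = 0" by (rule negligible_imp_measure0)
  then show False
    using content_ball_pos[OF \<open>e > 0\<close>, of x] measure_completion[of "ball x e" lborel] by simp
qed

text \<open>A fundamental system of \<open>y'' = - \<sigma> * y\<close> for every sign of
  \<open>\<sigma>\<close>: trigonometric, affine or hyperbolic. It spares a split into under-,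
  critically and overdamped motion later.\<close>

lemma ex_cosine_sine_like:
  fixes \<sigma> :: real
  obtains c s :: "real \<Rightarrow> real" where "c 0 = 1" "s 0 = 0"
    "\<And>t. (c has_real_derivative - \<sigma> * s t) (at t)" "\<And>t. (s has_real_derivative c t) (at t)"
proof -
  consider "\<sigma> > 0" | "\<sigma> = 0" | "\<sigma> < 0" by linarith
  then show ?thesis
  proof cases
    case 1
    define w where "w = sqrt \<sigma>"
    have w: "w > 0" "w * w = \<sigma>" using 1 by (auto simp: w_def)
    show ?thesis
      by (rule that[of "\<lambda>t. cos (w * t)" "\<lambda>t. sin (w * t) / w"])
         (use w in \<open>auto intro!: derivative_eq_intros simp: field_simps\<close>)
  next
    case 2
    show ?thesis
      by (rule that[of "\<lambda>t. 1" "\<lambda>t. t"]) (use 2 in \<open>auto intro!: derivative_eq_intros\<close>)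
  next
    case 3
    define w where "w = sqrt (- \<sigma>)"
    have w: "w > 0" "\<sigma> = - (w * w)" using 3 by (auto simp: w_def)
    show ?thesis
      by (rule that[of "\<lambda>t. cosh (w * t)" "\<lambda>t. sinh (w * t) / w"])
         (use w in \<open>auto intro!: derivative_eq_intros simp: field_simps\<close>)
  qed
qed

definition concat_at :: "real \<Rightarrow> (real \<Rightarrow> 'a) \<Rightarrow> (real \<Rightarrow> 'a) \<Rightarrow> real \<Rightarrow> 'a" where
  "concat_at S w u = (\<lambda>t. if t \<le> S then w t else u (t - S))"

locale bonding =
  fixes a k D :: real
  assumes a: "a > 0" and k: "k > 0" and D: "D > 0"
begin

definition velocity :: "real \<Rightarrow> real \<times> real \<Rightarrow> real \<times> real" where
  "velocity u z = (snd z, - a * snd z - k * fst z + k * D * u)"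

definition velocities :: "real \<times> real \<Rightarrow> (real \<times> real) set" where
  "velocities z = {velocity u z |u. u \<in> {-1..1} \<and> (fst z > 0 \<longrightarrow> u = 1) \<and> (fst z < 0 \<longrightarrow> u = - 1)}"

lemma velocities_pos: "fst z > 0 \<Longrightarrow> velocities z = {velocity 1 z}"
  by (auto simp: velocities_def)

text \<open>Reflection in the origin replaces \<open>u\<close> by \<open>- u\<close> and preserves
  the inclusion, so later arguments can be carried out on the side \<open>x > 0\<close> and
  transferred.\<close>

lemma uminus_mem_velocities: "- d \<in> velocities (- z) \<longleftrightarrow> d \<in> velocities z"
proof -
  have "- d \<in> velocities (- z)" if "d \<in> velocities z" for d z
  proof -
    obtain u where u: "d = velocity u z" "u \<in> {-1..1}" "fst z > 0 \<longrightarrow> u = 1" "fst z < 0 \<longrightarrow> u = - 1"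
      using \<open>d \<in> velocities z\<close> by (auto simp: velocities_def)
    then have "- d = velocity (- u) (- z)" by (simp add: velocity_def)
    then show ?thesis unfolding velocities_def using u by force
  qed
  from this[of d z] this[of "- d" "- z"] show ?thesis by auto
qed

text \<open>On a small ball without the null line \<open>x = 0\<close>, the field takes values in a
  closed rectangle, which therefore contains the closed convex hull. As the radius shrinks, the
  rectangles close in on a segment whose points are parametrized by \<open>u\<close>.\<close>

lemma filippov_set_subset_velocities:
  assumes Z: "\<And>x v. x \<noteq> 0 \<Longrightarrow> Z (x, v) = velocity (sgn x) (x, v)"
  shows "filippov_set Z z \<subseteq> velocities z"
proof
  fix d assume d: "d \<in> filippov_set Z z"
  obtain x v where z: "z = (x, v)" by fastforce
  obtain d1 d2 where d12: "d = (d1, d2)" by fastforce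
  \<comment> \<open>\<open>l\<close> and \<open>h\<close> bound \<open>sgn\<close> at nonzero points
    within distance \<open>r\<close> of \<open>x\<close>. Off the line they coincide, as
    \<open>r = \<bar>x\<bar>\<close> keeps the sign fixed. On the line any positive \<open>r\<close>
    would serve, and 1 is taken.\<close>
  define l :: real where "l = (if x > 0 then 1 else - 1)"
  define h :: real where "h = (if x < 0 then - 1 else 1)"
  define r :: real where "r = (if x = 0 then 1 else \<bar>x\<bar>)"
  have r: "r > 0" by (simp add: r_def)
  have lh: "l \<le> sgn x' \<and> sgn x' \<le> h" if "\<bar>x' - x\<bar> < r" "x' \<noteq> 0" for x'
    using that by (auto simp: l_def h_def r_def sgn_if split: if_splits)
  define c where "c = - a * v - k * x"
  have kD: "k * D > 0" using k D by simp
  have near: "\<bar>d1 - v\<bar> \<le> \<epsilon> \<and> c + k * D * l - (a + k) * \<epsilon> \<le> d2 \<and> d2 \<le> c + k * D * h + (a + k) * \<epsilon>"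
    if \<epsilon>: "0 < \<epsilon>" "\<epsilon> \<le> r" for \<epsilon>
  proof -
    define C where "C = {v - \<epsilon>..v + \<epsilon>} \<times> {c + k * D * l - (a + k) * \<epsilon>..c + k * D * h + (a + k) * \<epsilon>}"
    define S where "S = {y::real\<times>real. fst y = 0}"
    have S: "S \<in> null_sets lebesgue"
    proof -
      have "negligible {y. (1::real, 0::real) \<bullet> y = 0}" by (rule negligible_hyperplane) (auto simp: zero_prod_def)
      moreover have "{y. (1::real, 0::real) \<bullet> y = 0} = S" by (auto simp: S_def inner_prod_def)
      ultimately show ?thesis by (simp add: negligible_iff_null_sets)
    qed
    have "Z y \<in> C" if "y \<in> ball z \<epsilon> - S" for y
    proof -
      obtain x' v' where y: "y = (x', v')" by fastforce
      have x': "x' \<noteq> 0" using that by (auto simp: S_def y)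
      have "\<bar>x' - x\<bar> < \<epsilon>" "\<bar>v' - v\<bar> < \<epsilon>"
        using that dist_fst_le[of y z] dist_snd_le[of y z]
        by (auto simp: y z dist_commute dist_real_def)
      then have b: "x - \<epsilon> \<le> x'" "x' \<le> x + \<epsilon>" "v - \<epsilon> \<le> v'" "v' \<le> v + \<epsilon>" "\<bar>x' - x\<bar> < r" using \<epsilon> by auto
      have "a * (v - \<epsilon>) \<le> a * v'" "a * v' \<le> a * (v + \<epsilon>)" "k * (x - \<epsilon>) \<le> k * x'" "k * x' \<le> k * (x + \<epsilon>)"
        using a k b by (simp_all add: mult_left_mono)
      moreover have "k * D * l \<le> k * D * sgn x'" "k * D * sgn x' \<le> k * D * h"
        using lh[OF b(5) x'] kD by (simp_all add: mult_left_mono)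
      ultimately show ?thesis
        using b by (simp add: C_def y Z[OF x'] velocity_def c_def algebra_simps)
    qed
    then have "Z ` (ball z \<epsilon> - S) \<subseteq> C" by blast
    moreover have "convex C" "closed C" by (auto simp: C_def convex_Times closed_Times)
    ultimately have "closure (convex hull (Z ` (ball z \<epsilon> - S))) \<subseteq> C"
      by (simp add: closure_minimal hull_minimal)
    then have "d \<in> C" using d S \<epsilon> unfolding filippov_set_def by blast
    then show ?thesis by (auto simp: C_def d12)
  qed
  \<comment> \<open>The limit of vanishing radius; the factor \<open>1 + a + k\<close> dominates the
    errors of both components.\<close>
  have *: "p \<le> q" if "\<And>\<epsilon>. 0 < \<epsilon> \<Longrightarrow> \<epsilon> \<le> r \<Longrightarrow> p \<le> q + (1 + a + k) * \<epsilon>" for p q :: real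
  proof (rule field_le_epsilon)
    fix e :: real assume e: "e > 0"
    have M: "1 + a + k > 0" using a k by simp
    define \<epsilon> where "\<epsilon> = min r (e / (1 + a + k))"
    have "p \<le> q + (1 + a + k) * \<epsilon>" using that[of \<epsilon>] r e M by (simp add: \<epsilon>_def)
    also have "(1 + a + k) * \<epsilon> \<le> (1 + a + k) * (e / (1 + a + k))"
      using M by (intro mult_left_mono) (auto simp: \<epsilon>_def)
    also have "\<dots> = e" using M by simp
    finally show "p \<le> q + e" by simp
  qed
  have ge: "(a + k) * \<epsilon> \<le> (1 + a + k) * \<epsilon>" "\<epsilon> \<le> (1 + a + k) * \<epsilon>" if "\<epsilon> > 0" for \<epsilon>
    using that a k by (simp_all add: algebra_simps)
  have bounds: "d1 \<le> v + (1 + a + k) * \<epsilon>" "v \<le> d1 + (1 + a + k) * \<epsilon>"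
      "c + k * D * l \<le> d2 + (1 + a + k) * \<epsilon>" "d2 \<le> c + k * D * h + (1 + a + k) * \<epsilon>"
    if "0 < \<epsilon>" "\<epsilon> \<le> r" for \<epsilon>
    using near[OF that] ge[OF that(1)] by linarith+
  have "d1 \<le> v" "v \<le> d1" using *[OF bounds(1)] *[OF bounds(2)] by auto
  moreover have lo: "c + k * D * l \<le> d2" and hi: "d2 \<le> c + k * D * h"
    using *[OF bounds(3)] *[OF bounds(4)] by auto
  \<comment> \<open>The second component is solved for \<open>u\<close>; the limiting bounds say
    precisely that \<open>u\<close> lies between \<open>l\<close> and \<open>h\<close>.\<close>
  define u where "u = (d2 - c) / (k * D)"
  have "l \<le> u" "u \<le> h" using lo hi kD by (simp_all add: u_def field_simps)
  moreover have "k * D * u = d2 - c" using k D by (simp add: u_def)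
  ultimately have "d = velocity u z \<and> u \<in> {-1..1} \<and> (fst z > 0 \<longrightarrow> u = 1) \<and> (fst z < 0 \<longrightarrow> u = - 1)"
    by (auto simp: d12 z velocity_def c_def l_def h_def split: if_splits)
  then show "d \<in> velocities z" unfolding velocities_def by blast
qed

text \<open>The values for \<open>u = 1\<close> and \<open>u = - 1\<close> are limits of the field
  from the respective half-planes, even after deletion of a null set. On the line, intermediate
  values of \<open>u\<close> arise as convex combinations of these two.\<close>

lemma velocities_subset_filippov_set:
  assumes Z: "\<And>x v. x \<noteq> 0 \<Longrightarrow> Z (x, v) = velocity (sgn x) (x, v)"
  shows "velocities z \<subseteq> filippov_set Z z"
proof
  fix d assume d: "d \<in> velocities z"
  obtain x v where z: "z = (x, v)" by fastforce
  show "d \<in> filippov_set Z z"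
    unfolding filippov_set_def
  proof clarify
    fix \<delta> :: real and S :: "(real \<times> real) set"
    assume \<delta>: "\<delta> > 0" and S: "S \<in> null_sets lebesgue"
    define C where "C = closure (convex hull (Z ` (ball z \<delta> - S)))"
    have lim: "velocity u z \<in> C" if u: "\<bar>u\<bar> = 1" "u * x \<ge> 0" for u
    proof -
      have "velocity u z \<in> closure (Z ` (ball z \<delta> - S))"
        unfolding closure_approachable
      proof (intro allI impI)
        fix e :: real assume e: "e > 0"
        have M: "1 + a + k > 0" using a k by simp
        define \<epsilon> where "\<epsilon> = min \<delta> (e / (1 + a + k))"
        have \<epsilon>: "\<epsilon> > 0" "\<epsilon> \<le> \<delta>" "\<epsilon> \<le> e / (1 + a + k)"
          using e \<delta> M by (auto simp: \<epsilon>_def)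
        have "(1 + a + k) * \<epsilon> \<le> (1 + a + k) * (e / (1 + a + k))"
          using M \<epsilon>(3) by (intro mult_left_mono) auto
        then have \<epsilon>e: "(1 + a + k) * \<epsilon> \<le> e" using M by simp
        \<comment> \<open>The part of a small ball on the side selected by \<open>u\<close>, where
          the sign of the first coordinate is \<open>u\<close>. Shifting \<open>z\<close> by
          \<open>\<epsilon> / 2\<close> towards that side shows that it is nonempty, also if
          \<open>z\<close> is on the line.\<close>
        define W where "W = ball z \<epsilon> \<inter> {y. u * fst y > 0}"
        have "open W"
          unfolding W_def by (intro open_Int open_ball open_Collect_less continuous_intros)
        moreover have "(x + u * (\<epsilon> / 2), v) \<in> W"
          using \<epsilon> u by (auto simp: W_def z dist_prod_def dist_real_def abs_mult algebra_simps abs_if split: if_splits)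
        ultimately have "W - S \<noteq> {}"
          using S by (intro negligible_imp_open_diff_nonempty) (auto simp: negligible_iff_null_sets)
        then obtain y where "y \<in> W" "y \<notin> S" by blast
        obtain x' v' where y: "y = (x', v')" by fastforce
        have "u * x' > 0" "dist z y < \<epsilon>" using \<open>y \<in> W\<close> by (auto simp: W_def y)
        then have x': "x' \<noteq> 0" "sgn x' = u"
          using u by (auto simp: sgn_if zero_less_mult_iff abs_if split: if_splits)
        have "\<bar>x' - x\<bar> < \<epsilon>" "\<bar>v' - v\<bar> < \<epsilon>"
          using \<open>dist z y < \<epsilon>\<close> dist_fst_le[of y z] dist_snd_le[of y z]
          by (auto simp: y z dist_commute dist_real_def)
        have "dist (Z y) (velocity u z) \<le> dist (fst (Z y)) (fst (velocity u z)) + dist (snd (Z y)) (snd (velocity u z))"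
          unfolding dist_prod_def by (rule sqrt_sum_squares_le_sum) auto
        also have "\<dots> = \<bar>v' - v\<bar> + \<bar>a * (v' - v) + k * (x' - x)\<bar>"
          by (simp add: y Z[OF x'(1)] x' velocity_def z dist_real_def algebra_simps abs_minus_commute)
        also have "\<dots> \<le> \<bar>v' - v\<bar> + (a * \<bar>v' - v\<bar> + k * \<bar>x' - x\<bar>)"
          using a k abs_triangle_ineq[of "a * (v' - v)" "k * (x' - x)"] by (simp add: abs_mult)
        also have "\<dots> < \<epsilon> + (a * \<epsilon> + k * \<epsilon>)"
          using a k \<open>\<bar>x' - x\<bar> < \<epsilon>\<close> \<open>\<bar>v' - v\<bar> < \<epsilon>\<close> by (intro add_strict_mono mult_strict_left_mono)
        also have "\<dots> \<le> e" using \<epsilon>e by (simp add: algebra_simps)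
        finally have "dist (Z y) (velocity u z) < e" .
        moreover have "y \<in> ball z \<delta> - S" using \<open>dist z y < \<epsilon>\<close> \<epsilon> \<open>y \<notin> S\<close> by auto
        ultimately show "\<exists>y\<in>Z ` (ball z \<delta> - S). dist y (velocity u z) < e" by blast
      qed
      then show ?thesis unfolding C_def using closure_mono[OF hull_subset] by blast
    qed
    obtain u where u: "d = velocity u z" "u \<in> {-1..1}" "x > 0 \<longrightarrow> u = 1" "x < 0 \<longrightarrow> u = - 1"
      using d by (auto simp: velocities_def z)
    have "d \<in> C"
    proof (cases "x = 0")
      case True
      have "(1 - (1 + u) / 2) *\<^sub>R velocity (- 1) z + ((1 + u) / 2) *\<^sub>R velocity 1 z \<in> C"
        using u(2) lim[of 1] lim[of "- 1"] True unfolding C_def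
        by (intro convexD_alt convex_closure convex_convex_hull) auto
      moreover have "(1 - (1 + u) / 2) *\<^sub>R velocity (- 1) z + ((1 + u) / 2) *\<^sub>R velocity 1 z = d"
        by (simp add: u(1) velocity_def z field_simps)
      ultimately show ?thesis by simp
    next
      case False
      then show ?thesis using lim[of u] u by (auto simp: neq_iff)
    qed
    then show "d \<in> closure (convex hull (Z ` (ball z \<delta> - S)))" by (simp add: C_def)
  qed
qed

lemma filippov_set_eq_velocities:
  assumes "\<And>x v. x \<noteq> 0 \<Longrightarrow> Z (x, v) = velocity (sgn x) (x, v)"
  shows "filippov_set Z = velocities"
  using filippov_set_subset_velocities[of Z] velocities_subset_filippov_set[of Z] assms by blast

definition solution :: "(real \<Rightarrow> real \<times> real) \<Rightarrow> bool" where
  "solution z \<longleftrightarrow> (\<forall>T\<ge>0. abs_continuous_on 0 T z) \<and>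
     (AE t in lebesgue. t \<ge> 0 \<longrightarrow> (\<exists>d. (z has_vector_derivative d) (at t) \<and> d \<in> velocities (z t)))"

lemma filippov_solution_iff_solution:
  assumes "\<And>x v. x \<noteq> 0 \<Longrightarrow> Z (x, v) = velocity (sgn x) (x, v)"
  shows "filippov_solution Z z \<longleftrightarrow> solution z"
  by (simp add: filippov_solution_def solution_def filippov_set_eq_velocities[OF assms])

subsection \<open>Forward uniqueness away from the origin\<close>

lemma solution_uminus:
  assumes "solution z"
  shows "solution (\<lambda>t. - z t)"
  unfolding solution_def
proof (intro conjI allI impI)
  show "abs_continuous_on 0 T (\<lambda>t. - z t)" if "T \<ge> 0" for T
    using assms that abs_continuous_on_bounded_linear[OF bounded_linear_minus[OF bounded_linear_ident], of 0 T z]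
    unfolding solution_def by blast
  have "AE t in lebesgue. t \<ge> 0 \<longrightarrow> (\<exists>d. (z has_vector_derivative d) (at t) \<and> d \<in> velocities (z t))"
    using assms by (simp add: solution_def)
  then show "AE t in lebesgue. t \<ge> 0 \<longrightarrow>
      (\<exists>d. ((\<lambda>t. - z t) has_vector_derivative d) (at t) \<and> d \<in> velocities (- z t))"
  proof eventually_elim
    case (elim t)
    then show ?case using has_vector_derivative_minus uminus_mem_velocities by blast
  qed
qed

lemma solution_continuous_on:
  assumes "solution z" "0 \<le> s"
  shows "continuous_on {s..t} z"
proof (cases "0 \<le> t")
  case True
  then have "continuous_on {0..t} z"
    using assms(1) by (auto simp: solution_def intro: abs_continuous_on_imp_continuous_on)
  then show ?thesis by (rule continuous_on_subset) (use assms in auto)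
qed (use assms in auto)

lemma solution_isCont:
  assumes "solution z" "0 < t"
  shows "isCont z t"
  using solution_continuous_on[OF assms(1) order_refl, of "t + 1"] assms(2)
  by (auto intro: continuous_on_interior)

text \<open>The first component of the inclusion is single-valued and continuous along a solution,
  so position is differentiable at every time, including the crossing times.\<close>

lemma solution_fst_deriv:
  assumes z: "solution z" and s: "0 \<le> s" and t: "t \<in> {s..u}"
  shows "((\<lambda>t. fst (z t)) has_real_derivative snd (z t)) (at t within {s..u})"
proof (rule abs_continuous_on_AE_deriv_continuous[where f = "\<lambda>t. fst (z t)" and g = "\<lambda>t. snd (z t)", OF _ _ _ t])
  have "abs_continuous_on 0 u z" using z s t by (auto simp: solution_def)
  then have "abs_continuous_on s u z" by (rule abs_continuous_on_subinterval) (use s in auto)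
  then show "abs_continuous_on s u (\<lambda>t. fst (z t))"
    by (rule abs_continuous_on_bounded_linear[OF bounded_linear_fst])
  show "continuous_on {s..u} (\<lambda>t. snd (z t))"
    by (intro continuous_intros solution_continuous_on z s)
  have "AE t in lebesgue. t \<ge> 0 \<longrightarrow> (\<exists>d. (z has_vector_derivative d) (at t) \<and> d \<in> velocities (z t))"
    using z by (simp add: solution_def)
  then show "AE t in lebesgue. s < t \<and> t < u \<longrightarrow> ((\<lambda>t. fst (z t)) has_real_derivative snd (z t)) (at t)"
  proof eventually_elim
    case (elim t)
    show ?case
    proof
      assume "s < t \<and> t < u"
      then obtain d where d: "(z has_vector_derivative d) (at t)" "d \<in> velocities (z t)" using elim s by auto
      then have "fst d = snd (z t)" by (auto simp: velocities_def velocity_def)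
      then show "((\<lambda>t. fst (z t)) has_real_derivative snd (z t)) (at t)"
        using bounded_linear.has_vector_derivative[OF bounded_linear_fst d(1)]
        by (simp add: has_real_derivative_iff_has_vector_derivative)
    qed
  qed
qed

text \<open>Positivity is required only in the open interval: the linear right-hand side is
  continuous up to the endpoints, which may lie on the line \<open>x = 0\<close>.\<close>

lemma solution_snd_deriv:
  assumes z: "solution z" and s: "0 \<le> s" and t: "t \<in> {s..u}"
    and pos: "\<And>\<tau>. s < \<tau> \<Longrightarrow> \<tau> < u \<Longrightarrow> fst (z \<tau>) > 0"
  shows "((\<lambda>t. snd (z t)) has_real_derivative - a * snd (z t) - k * fst (z t) + k * D) (at t within {s..u})"
proof (rule abs_continuous_on_AE_deriv_continuous[where f = "\<lambda>t. snd (z t)"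
      and g = "\<lambda>t. - a * snd (z t) - k * fst (z t) + k * D", OF _ _ _ t])
  have "abs_continuous_on 0 u z" using z s t by (auto simp: solution_def)
  then have "abs_continuous_on s u z" by (rule abs_continuous_on_subinterval) (use s in auto)
  then show "abs_continuous_on s u (\<lambda>t. snd (z t))"
    by (rule abs_continuous_on_bounded_linear[OF bounded_linear_snd])
  show "continuous_on {s..u} (\<lambda>t. - a * snd (z t) - k * fst (z t) + k * D)"
    by (intro continuous_intros solution_continuous_on z s)
  have "AE t in lebesgue. t \<ge> 0 \<longrightarrow> (\<exists>d. (z has_vector_derivative d) (at t) \<and> d \<in> velocities (z t))"
    using z by (simp add: solution_def)
  then show "AE t in lebesgue. s < t \<and> t < u \<longrightarrow>
      ((\<lambda>t. snd (z t)) has_real_derivative - a * snd (z t) - k * fst (z t) + k * D) (at t)"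
  proof eventually_elim
    case (elim t)
    show ?case
    proof
      assume st: "s < t \<and> t < u"
      then obtain d where d: "(z has_vector_derivative d) (at t)" "d \<in> velocities (z t)" using elim s by auto
      then have "d = velocity 1 (z t)" using velocities_pos pos st by auto
      then show "((\<lambda>t. snd (z t)) has_real_derivative - a * snd (z t) - k * fst (z t) + k * D) (at t)"
        using bounded_linear.has_vector_derivative[OF bounded_linear_snd d(1)]
        by (simp add: has_real_derivative_iff_has_vector_derivative velocity_def)
    qed
  qed
qed

text \<open>On the line with positive velocity, continuity keeps the velocity positive for a while,
  so the position becomes positive at once.\<close>

lemma positive_after:
  assumes z: "solution z" and s: "0 \<le> s" and "fst (z s) > 0 \<or> fst (z s) = 0 \<and> snd (z s) > 0"
  obtains u where "s < u" "\<And>t. s < t \<Longrightarrow> t \<le> u \<Longrightarrow> fst (z t) > 0"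
proof -
  have right: "\<exists>d>0. \<forall>t\<in>{s..s+1}. \<bar>t - s\<bar> < d \<longrightarrow> f t > 0"
    if c: "continuous_on {s..s+1} f" and fs: "f s > 0" for f :: "real \<Rightarrow> real"
  proof -
    obtain d where "d > 0" "\<And>t. t \<in> {s..s+1} \<Longrightarrow> dist t s < d \<Longrightarrow> dist (f t) (f s) < f s"
      using c[unfolded continuous_on_iff, rule_format, of s "f s"] fs by auto
    then show ?thesis by (intro exI[of _ d]) (force simp: dist_real_def)
  qed
  have cont: "continuous_on {s..s+1} (\<lambda>t. fst (z t))" "continuous_on {s..s+1} (\<lambda>t. snd (z t))"
    by (intro continuous_intros solution_continuous_on z s)+
  show ?thesis
  proof (cases "fst (z s) > 0")
    case True
    obtain d where d: "d > 0" "\<And>t. t \<in> {s..s+1} \<Longrightarrow> \<bar>t - s\<bar> < d \<Longrightarrow> fst (z t) > 0"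
      using right[OF cont(1) True] by blast
    \<comment> \<open>The minimum with 1 stays inside the interval on which continuity was
      recorded.\<close>
    show ?thesis
      by (rule that[of "s + min 1 (d/2)"]) (use d in auto)
  next
    case False
    then have z0: "fst (z s) = 0" "snd (z s) > 0" using assms(3) by auto
    obtain d where d: "d > 0" "\<And>t. t \<in> {s..s+1} \<Longrightarrow> \<bar>t - s\<bar> < d \<Longrightarrow> snd (z t) > 0"
      using right[OF cont(2) z0(2)] by blast
    show ?thesis
    proof (rule that[of "s + min 1 (d/2)"])
      show "s < s + min 1 (d/2)" using d by auto
      fix t assume t: "s < t" "t \<le> s + min 1 (d/2)"
      have "fst (z s) < fst (z t)"
      proof (rule DERIV_pos_imp_increasing_open[OF t(1)])
        fix x assume x: "s < x" "x < t"
        have "((\<lambda>t. fst (z t)) has_real_derivative snd (z x)) (at x)"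
          using solution_fst_deriv[OF z s, of x t] x at_within_interior[of x "{s..t}"] by auto
        moreover have "snd (z x) > 0" using d(2)[of x] x t d(1) by (auto simp: min_def split: if_splits)
        ultimately show "\<exists>y. ((\<lambda>t. fst (z t)) has_real_derivative y) (at x) \<and> 0 < y" by blast
      qed (use continuous_on_subset[OF cont(1)] t in auto)
      then show "fst (z t) > 0" using z0 by simp
    qed
  qed
qed

text \<open>Both solutions obey the same linear equation; \<open>k p\<^sup>2 + q\<^sup>2\<close> is nonincreasing for their difference \<open>(p, q)\<close>.\<close>

lemma local_uniqueness_pos:
  assumes z: "solution z" and w: "solution w" and s: "0 \<le> s" and eq: "z s = w s"
    and pos: "fst (z s) > 0 \<or> fst (z s) = 0 \<and> snd (z s) > 0"
  obtains u where "s < u" "\<And>t. s \<le> t \<Longrightarrow> t \<le> u \<Longrightarrow> z t = w t"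
proof -
  obtain u1 where u1: "s < u1" "\<And>t. s < t \<Longrightarrow> t \<le> u1 \<Longrightarrow> fst (z t) > 0"
    using positive_after[OF z s pos] by blast
  obtain u2 where u2: "s < u2" "\<And>t. s < t \<Longrightarrow> t \<le> u2 \<Longrightarrow> fst (w t) > 0"
    using positive_after[OF w s] pos eq by auto
  define u where "u = min u1 u2"
  have posz: "\<And>t. s < t \<Longrightarrow> t < u \<Longrightarrow> fst (z t) > 0" and posw: "\<And>t. s < t \<Longrightarrow> t < u \<Longrightarrow> fst (w t) > 0"
    using u1 u2 by (auto simp: u_def)
  define p where "p t = fst (z t) - fst (w t)" for t
  define q where "q t = snd (z t) - snd (w t)" for t
  have dp: "(p has_real_derivative q t) (at t within {s..u})" if "t \<in> {s..u}" for t
    unfolding p_def q_def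
    by (intro DERIV_diff solution_fst_deriv z w s that)
  have dq: "(q has_real_derivative - a * q t - k * p t) (at t within {s..u})" if "t \<in> {s..u}" for t
  proof -
    have "(q has_real_derivative (- a * snd (z t) - k * fst (z t) + k * D) - (- a * snd (w t) - k * fst (w t) + k * D))
       (at t within {s..u})"
      unfolding q_def by (intro DERIV_diff solution_snd_deriv z w s that posz posw)
    then show ?thesis by (simp add: p_def q_def algebra_simps)
  qed
  define W where "W t = k * (p t)\<^sup>2 + (q t)\<^sup>2" for t
  have dW: "(W has_real_derivative - 2 * a * (q t)\<^sup>2) (at t within {s..u})" if "t \<in> {s..u}" for t
    unfolding W_def using dp[OF that] dq[OF that]
    by (auto intro!: derivative_eq_intros simp: power2_eq_square algebra_simps)
  have "z t = w t" if t: "s \<le> t" "t \<le> u" for t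
  proof -
    have "W t \<le> W s"
    proof (rule DERIV_nonpos_imp_decreasing_open[OF t(1)])
      fix x assume x: "s < x" "x < t"
      then have "(W has_real_derivative - 2 * a * (q x)\<^sup>2) (at x)"
        using dW[of x] t at_within_interior[of x "{s..u}"] by auto
      then show "\<exists>y. (W has_real_derivative y) (at x) \<and> y \<le> 0" using a by (auto intro!: exI[of _ "- 2 * a * (q x)\<^sup>2"])
    next
      have "continuous_on {s..u} W" using dW by (meson DERIV_continuous continuous_on_eq_continuous_within)
      then show "continuous_on {s..t} W" by (rule continuous_on_subset) (use t in auto)
    qed
    also have "W s = 0" by (simp add: W_def p_def q_def eq)
    finally have "k * (p t)\<^sup>2 + (q t)\<^sup>2 \<le> 0" by (simp add: W_def)
    moreover have "k * (p t)\<^sup>2 \<ge> 0" "(q t)\<^sup>2 \<ge> 0" using k by auto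
    ultimately have "k * (p t)\<^sup>2 = 0" "(q t)\<^sup>2 = 0" by linarith+
    then show ?thesis using k by (simp add: p_def q_def prod_eq_iff)
  qed
  then show ?thesis using that[of u] u1 u2 by (auto simp: u_def)
qed

text \<open>At a nonzero point either the state or its reflection satisfies the hypothesis of the
  positive case.\<close>

lemma local_uniqueness:
  assumes z: "solution z" and w: "solution w" and s: "0 \<le> s" and eq: "z s = w s" and nz: "z s \<noteq> 0"
  obtains u where "s < u" "\<And>t. s \<le> t \<Longrightarrow> t \<le> u \<Longrightarrow> z t = w t"
proof (cases "fst (z s) > 0 \<or> fst (z s) = 0 \<and> snd (z s) > 0")
  case True
  then show ?thesis using local_uniqueness_pos[OF z w s eq] that by blast
next
  case False
  then have "fst (- z s) > 0 \<or> fst (- z s) = 0 \<and> snd (- z s) > 0" using nz by (auto simp: prod_eq_iff)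
  then obtain u where "s < u" "\<And>t. s \<le> t \<Longrightarrow> t \<le> u \<Longrightarrow> - z t = - w t"
    using local_uniqueness_pos[OF solution_uminus[OF z] solution_uminus[OF w] s] eq by auto
  then show ?thesis using that by auto
qed

text \<open>At the infimum \<open>s\<close> of the times of disagreement the solutions still agree
  by continuity. Their common value is that of \<open>z\<close>, hence nonzero, and local uniqueness
  extends the agreement beyond \<open>s\<close>.\<close>

lemma uniqueness:
  assumes z: "solution z" and w: "solution w" and eq: "z 0 = w 0"
    and nz: "\<And>t. 0 \<le> t \<Longrightarrow> z t \<noteq> 0" and t: "0 \<le> t"
  shows "z t = w t"
proof (rule ccontr)
  assume neq: "z t \<noteq> w t"
  define A where "A = {r. 0 \<le> r \<and> z r \<noteq> w r}"
  have A: "t \<in> A" "bdd_below A" using t neq by (auto simp: A_def)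
  define s where "s = Inf A"
  have s0: "0 \<le> s" unfolding s_def using A by (intro cInf_greatest) (auto simp: A_def)
  have st: "s \<le> t" unfolding s_def using A by (intro cInf_lower)
  have before: "z r = w r" if "0 \<le> r" "r < s" for r
    using that cInf_lower[OF _ A(2), of r] by (fastforce simp: A_def s_def)
  have "z s = w s"
  proof (cases "s = 0")
    case False
    have "closure {0..<s} = {0..s}" using False s0 by simp
    moreover have "continuous_on {0..s} z" "continuous_on {0..s} w"
      using solution_continuous_on z w by auto
    ultimately have "continuous_on (closure {0..<s}) (\<lambda>r. z r - w r)"
      by (simp add: continuous_on_diff)
    then have "z s - w s = 0"
      by (rule continuous_constant_on_closure) (use before False s0 in auto)
    then show ?thesis by simp
  qed (use eq in simp)
  then obtain u where u: "s < u" "\<And>r. s \<le> r \<Longrightarrow> r \<le> u \<Longrightarrow> z r = w r"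
    using local_uniqueness[OF z w s0] nz s0 by blast
  have "u \<le> r" if "r \<in> A" for r
    using that before[of r] u(2)[of r] by (force simp: A_def)
  then have "u \<le> s" unfolding s_def using A by (intro cInf_greatest) auto
  then show False using u by simp
qed

subsection \<open>Energy decay and the limit distance\<close>

definition energy :: "real \<times> real \<Rightarrow> real" where
  "energy z = (snd z)\<^sup>2 / 2 + k / 2 * (\<bar>fst z\<bar> - D)\<^sup>2"

lemma energy_uminus [simp]: "energy (- z) = energy z"
  by (simp add: energy_def)

lemma energy_nonneg: "energy z \<ge> 0"
  using k by (simp add: energy_def)

lemma snd_sq_le_energy: "(snd z)\<^sup>2 \<le> 2 * energy z"
  using k by (simp add: energy_def)

text \<open>Below \<open>D\<close> the function \<open>exp (a t) * v t\<close> increases.\<close>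

lemma strictly_increasing_below_rest_distance:
  fixes x v :: "real \<Rightarrow> real"
  assumes su: "s < u"
    and x: "\<And>t. t \<in> {s..u} \<Longrightarrow> (x has_real_derivative v t) (at t within {s..u})"
    and v: "\<And>t. t \<in> {s..u} \<Longrightarrow> (v has_real_derivative - a * v t - k * x t + k * D) (at t within {s..u})"
    and vs: "v s \<ge> 0" and xD: "\<And>t. s < t \<Longrightarrow> t < u \<Longrightarrow> x t < D"
  shows "x s < x u"
proof -
  have at: "at t within {s..u} = at t" if "s < t" "t < u" for t
    using that by (intro at_within_interior) auto
  have cont: "continuous_on {s..u} x" "continuous_on {s..u} v"
    using x v by (meson DERIV_continuous continuous_on_eq_continuous_within)+
  have vpos: "v t > 0" if t: "s < t" "t < u" for t
  proof -
    define w where "w r = exp (a * r) * v r" for r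
    have "w s < w t"
    proof (rule DERIV_pos_imp_increasing_open[OF t(1)])
      fix r assume r: "s < r" "r < t"
      have "(v has_real_derivative - a * v r - k * x r + k * D) (at r)"
        using v[of r] r t at by auto
      then have "(w has_real_derivative exp (a * r) * (k * (D - x r))) (at r)"
        unfolding w_def by (auto intro!: derivative_eq_intros simp: algebra_simps)
      moreover have "exp (a * r) * (k * (D - x r)) > 0" using xD[of r] r t k by simp
      ultimately show "\<exists>y. (w has_real_derivative y) (at r) \<and> 0 < y" by blast
    next
      have "continuous_on {s..t} v" by (rule continuous_on_subset[OF cont(2)]) (use t in auto)
      then show "continuous_on {s..t} w" unfolding w_def by (intro continuous_intros)
    qed
    moreover have "w s \<ge> 0" using vs by (simp add: w_def)
    ultimately have "0 < exp (a * t) * v t" by (simp add: w_def)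
    then show ?thesis by (simp add: zero_less_mult_iff)
  qed
  show ?thesis
  proof (rule DERIV_pos_imp_increasing_open[OF su _ cont(1)])
    fix t assume "s < t" "t < u"
    then show "\<exists>y. (x has_real_derivative y) (at t) \<and> 0 < y" using x[of t] at vpos by auto
  qed
qed

lemma solution_pos_nbhd:
  assumes z: "solution z" and t: "0 < t" and pos: "fst (z t) > 0"
  obtains e where "e > 0" "e < t" "\<And>r. \<bar>r - t\<bar> \<le> e \<Longrightarrow> fst (z r) > 0"
proof -
  have "((\<lambda>r. fst (z r)) \<longlongrightarrow> fst (z t)) (at t)"
    using solution_isCont[OF z t] by (intro tendsto_fst) (simp add: isCont_def)
  then have "eventually (\<lambda>r. 0 < fst (z r)) (at t)" using pos order_tendstoD(1) by blast
  then obtain d where d: "d > 0" "\<And>r. r \<noteq> t \<Longrightarrow> dist r t < d \<Longrightarrow> 0 < fst (z r)"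
    by (auto simp: eventually_at)
  show ?thesis
  proof (rule that[of "min d t / 2"])
    fix r assume r: "\<bar>r - t\<bar> \<le> min d t / 2"
    then show "fst (z r) > 0" using d t pos by (cases "r = t") (auto simp: dist_real_def min_def split: if_splits)
  qed (use d t in \<open>auto simp: min_def\<close>)
qed

lemma energy_deriv_pos:
  assumes z: "solution z" and t: "0 < t" and pos: "fst (z t) > 0"
  shows "((\<lambda>t. energy (z t)) has_real_derivative - a * (snd (z t))\<^sup>2) (at t)"
proof -
  obtain e where e: "e > 0" "e < t" "\<And>r. \<bar>r - t\<bar> \<le> e \<Longrightarrow> fst (z r) > 0"
    using solution_pos_nbhd[OF z t pos] by blast
  have at: "at t within {t - e..t + e} = at t" by (rule at_within_interior) (use e in auto)
  have x: "((\<lambda>t. fst (z t)) has_real_derivative snd (z t)) (at t)"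
    using solution_fst_deriv[OF z, of "t - e" t "t + e"] e at by auto
  have v: "((\<lambda>t. snd (z t)) has_real_derivative - a * snd (z t) - k * fst (z t) + k * D) (at t)"
    using solution_snd_deriv[OF z, of "t - e" t "t + e"] e at by auto
  have "((\<lambda>t. (snd (z t))\<^sup>2 / 2 + k / 2 * (fst (z t) - D)\<^sup>2) has_real_derivative - a * (snd (z t))\<^sup>2) (at t)"
    by (auto intro!: derivative_eq_intros x v simp: power2_eq_square field_simps)
  then show ?thesis
  proof (rule has_field_derivative_transform_within_open)
    show "open {t - e<..<t + e}" "t \<in> {t - e<..<t + e}" using e by auto
    show "(snd (z r))\<^sup>2 / 2 + k / 2 * (fst (z r) - D)\<^sup>2 = energy (z r)" if "r \<in> {t - e<..<t + e}" for r
    proof -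
      have "\<bar>r - t\<bar> \<le> e" using that by (auto simp: abs_le_iff)
      then show ?thesis using e(3)[of r] by (simp add: energy_def)
    qed
  qed
qed

lemma energy_deriv:
  assumes z: "solution z" and t: "0 < t" and nz: "fst (z t) \<noteq> 0"
  shows "((\<lambda>t. energy (z t)) has_real_derivative - a * (snd (z t))\<^sup>2) (at t)"
  using energy_deriv_pos[OF z t] energy_deriv_pos[OF solution_uminus[OF z] t] nz by fastforce

text \<open>A zero of the position has nonzero velocity, as the origin is avoided, so zeros are
  isolated. A compact set without limit points of its own is finite. Thus energy can be integrated
  across the crossings.\<close>

lemma finite_zeros:
  assumes z: "solution z" and nz: "\<And>t. 0 \<le> t \<Longrightarrow> z t \<noteq> 0" and s: "0 \<le> s"
  shows "finite {t \<in> {s..u}. fst (z t) = 0}"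
proof -
  define A where "A = {t \<in> {s..u}. fst (z t) = 0}"
  have "continuous_on {s..u} (\<lambda>t. fst (z t))"
    by (intro continuous_intros solution_continuous_on z s)
  then have "closed A" unfolding A_def
    using continuous_closed_preimage_constant[OF _ closed_atLeastAtMost] by blast
  moreover have "bounded A" by (rule bounded_subset[of "{s..u}"]) (auto simp: A_def)
  ultimately have "compact A" by (simp add: compact_eq_bounded_closed)
  moreover have "\<not> t islimpt A" if t: "t \<in> A" for t
  proof -
    have "snd (z t) \<noteq> 0" using nz[of t] t s by (auto simp: A_def prod_eq_iff)
    moreover have "((\<lambda>r. (fst (z r) - fst (z t)) / (r - t)) \<longlongrightarrow> snd (z t)) (at t within {s..u})"
      using solution_fst_deriv[OF z s, of t u] t by (simp add: A_def has_field_derivative_iff)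
    ultimately have "eventually (\<lambda>r. (fst (z r) - fst (z t)) / (r - t) \<noteq> 0) (at t within {s..u})"
      using tendsto_imp_eventually_ne by blast
    then have "eventually (\<lambda>r. r \<notin> A) (at t)"
      unfolding eventually_at_filter by eventually_elim (use t in \<open>auto simp: A_def\<close>)
    then show ?thesis by (simp add: islimpt_iff_eventually)
  qed
  ultimately have "finite (A \<inter> A)" by (intro finite_not_islimpt_in_compact)
  then show ?thesis by (simp add: A_def)
qed

text \<open>Energy is continuous everywhere and differentiable off the finitely many crossings,
  which suffices for the fundamental theorem of calculus. With \<open>c = 0\<close> this is
  monotonicity; with \<open>c > 0\<close> it measures the cost of moving fast.\<close>

lemma energy_drop:
  assumes z: "solution z" and nz: "\<And>t. 0 \<le> t \<Longrightarrow> z t \<noteq> 0" and s: "0 \<le> s" and su: "s \<le> u"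
    and c: "\<And>t. t \<in> {s..u} \<Longrightarrow> c \<le> (snd (z t))\<^sup>2"
  shows "energy (z u) \<le> energy (z s) - a * c * (u - s)"
proof -
  have "((\<lambda>t. - a * (snd (z t))\<^sup>2) has_integral (energy (z u) - energy (z s))) {s..u}"
  proof (rule fundamental_theorem_of_calculus_interior_strong[OF finite_zeros[OF z nz s, of u] su])
    show "((\<lambda>t. energy (z t)) has_vector_derivative - a * (snd (z t))\<^sup>2) (at t)"
      if "t \<in> {s<..<u} - {t \<in> {s..u}. fst (z t) = 0}" for t
      using energy_deriv[OF z, of t] that s
      by (auto simp: has_real_derivative_iff_has_vector_derivative)
    show "continuous_on {s..u} (\<lambda>t. energy (z t))"
      unfolding energy_def by (intro continuous_intros solution_continuous_on z s) auto
  qed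
  moreover have "((\<lambda>t. - a * c) has_integral (- a * c * (u - s))) {s..u}"
    using has_integral_const_real[of "- a * c" s u] su by (simp add: mult.commute)
  ultimately have "energy (z u) - energy (z s) \<le> - a * c * (u - s)"
    by (rule has_integral_le) (use c a in auto)
  then show ?thesis by simp
qed

text \<open>Bounded energy bounds position and velocity, hence every admissible acceleration.
  Velocity may have kinks at crossings, so the bound is integrated through absolute
  continuity.\<close>

lemma snd_lipschitz:
  assumes z: "solution z" and nz: "\<And>t. 0 \<le> t \<Longrightarrow> z t \<noteq> 0"
  obtains M where "M > 0" "\<And>s u. 0 \<le> s \<Longrightarrow> s \<le> u \<Longrightarrow> \<bar>snd (z u) - snd (z s)\<bar> \<le> M * (u - s)"
proof -
  define E where "E = energy (z 0)"
  have E: "energy (z t) \<le> E" if "0 \<le> t" for t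
    using energy_drop[OF z nz order_refl that, of 0] by (simp add: E_def)
  define V where "V = sqrt (2 * E)"
  define X where "X = D + sqrt (2 * E / k)"
  have V: "\<bar>snd (z t)\<bar> \<le> V" if "0 \<le> t" for t
    unfolding V_def by (rule real_le_rsqrt) (use E[OF that] snd_sq_le_energy[of "z t"] in simp)
  have X: "\<bar>fst (z t)\<bar> \<le> X" if "0 \<le> t" for t
  proof -
    have "k / 2 * (\<bar>fst (z t)\<bar> - D)\<^sup>2 \<le> E"
      using E[OF that] zero_le_power2[of "snd (z t)"] unfolding energy_def by linarith
    then have "(\<bar>fst (z t)\<bar> - D)\<^sup>2 \<le> 2 * E / k" using k by (simp add: field_simps)
    then have "\<bar>fst (z t)\<bar> - D \<le> sqrt (2 * E / k)" by (rule real_le_rsqrt)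
    then show ?thesis by (simp add: X_def)
  qed
  define M where "M = a * V + k * X + k * D"
  have "V \<ge> 0" "X \<ge> 0" using V[of 0] X[of 0] by auto
  then have M: "M > 0" using a k D by (simp add: M_def add_nonneg_pos)
  have dM: "\<bar>snd d\<bar> \<le> M" if "d \<in> velocities (z t)" "0 \<le> t" for d t
  proof -
    obtain u where u: "d = velocity u (z t)" "u \<in> {-1..1}" using \<open>d \<in> velocities (z t)\<close> unfolding velocities_def by blast
    then have "\<bar>u\<bar> \<le> 1" by auto
    have "\<bar>a * snd (z t)\<bar> \<le> a * V" "\<bar>k * fst (z t)\<bar> \<le> k * X" "\<bar>k * D * u\<bar> \<le> k * D"
      using V[OF that(2)] X[OF that(2)] a k D \<open>\<bar>u\<bar> \<le> 1\<close> by (simp_all add: abs_mult)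
    then show ?thesis by (simp add: u velocity_def M_def)
  qed
  \<comment> \<open>Only the upper estimate is proved, by monotonicity of
    \<open>snd (z t) - M * t\<close>. It is stated for an arbitrary solution so that the reflected
    one yields the lower estimate.\<close>
  have ub: "snd (z u) - snd (z s) \<le> M * (u - s)"
    if z: "solution z" and dM: "\<And>t d. d \<in> velocities (z t) \<Longrightarrow> 0 \<le> t \<Longrightarrow> \<bar>snd d\<bar> \<le> M"
      and s: "0 \<le> s" "s \<le> u" for s u z
  proof -
    have "(\<lambda>t. snd (z t) - M * t) u \<le> (\<lambda>t. snd (z t) - M * t) s"
    proof (rule abs_continuous_on_deriv_nonpos_le[OF abs_continuous_on_diff s(2)])
      have "abs_continuous_on 0 u z" using z s by (auto simp: solution_def)
      then have "abs_continuous_on s u z" by (rule abs_continuous_on_subinterval) (use s in auto)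
      then show "abs_continuous_on s u (\<lambda>t. snd (z t))"
        by (rule abs_continuous_on_bounded_linear[OF bounded_linear_snd])
      have "M-lipschitz_on {s..u} ((*) M)"
        using M by (intro lipschitz_onI) (auto simp: dist_real_def abs_mult simp flip: right_diff_distrib)
      then show "abs_continuous_on s u ((*) M)" by (rule lipschitz_on_imp_abs_continuous_on)
      have "AE t in lebesgue. t \<ge> 0 \<longrightarrow> (\<exists>d. (z has_vector_derivative d) (at t) \<and> d \<in> velocities (z t))"
        using z by (simp add: solution_def)
      then show "AE t in lebesgue. s < t \<and> t < u \<longrightarrow>
          (\<exists>d\<le>0. ((\<lambda>t. snd (z t) - M * t) has_real_derivative d) (at t))"
      proof eventually_elim
        case (elim t)
        show ?case
        proof
          assume st: "s < t \<and> t < u"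
          then obtain d where d: "(z has_vector_derivative d) (at t)" "d \<in> velocities (z t)" using elim s by auto
          have "((\<lambda>t. snd (z t)) has_real_derivative snd d) (at t)"
            using bounded_linear.has_vector_derivative[OF bounded_linear_snd d(1)]
            by (simp add: has_real_derivative_iff_has_vector_derivative)
          then have "((\<lambda>t. snd (z t) - M * t) has_real_derivative snd d - M) (at t)"
            by (auto intro!: derivative_eq_intros)
          moreover have "snd d - M \<le> 0" using dM[OF d(2)] st s by auto
          ultimately show "\<exists>d\<le>0. ((\<lambda>t. snd (z t) - M * t) has_real_derivative d) (at t)" by blast
        qed
      qed
    qed
    then show ?thesis by (simp add: algebra_simps)
  qed
  have "\<bar>snd (z u) - snd (z s)\<bar> \<le> M * (u - s)" if su: "0 \<le> s" "s \<le> u" for s u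
  proof -
    have "\<bar>snd d\<bar> \<le> M" if "d \<in> velocities (- z t)" "0 \<le> t" for t d
      using dM[of "- d" t] that uminus_mem_velocities[of "- d" "z t"] by simp
    then show ?thesis
      using ub[OF z dM su] ub[OF solution_uminus[OF z] _ su] by (simp add: abs_le_iff)
  qed
  then show ?thesis using that M by blast
qed

text \<open>A speed above \<open>\<eta>\<close> stays above \<open>\<eta> / 2\<close> for the time
  \<open>h\<close> by the Lipschitz bound and so costs the energy \<open>l\<close>. After the energy
  has come within \<open>l\<close> of its infimum this is impossible.\<close>

lemma velocity_tendsto_0:
  assumes z: "solution z" and nz: "\<And>t. 0 \<le> t \<Longrightarrow> z t \<noteq> 0" and \<eta>: "\<eta> > 0"
  obtains T where "T \<ge> 0" "\<And>t. t \<ge> T \<Longrightarrow> \<bar>snd (z t)\<bar> \<le> \<eta>"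
proof -
  obtain M where M: "M > 0" "\<And>s u. 0 \<le> s \<Longrightarrow> s \<le> u \<Longrightarrow> \<bar>snd (z u) - snd (z s)\<bar> \<le> M * (u - s)"
    using snd_lipschitz[OF z nz] by blast
  define h where "h = \<eta> / (2 * M)"
  have h: "h > 0" "M * h = \<eta> / 2" using \<eta> M by (auto simp: h_def)
  define l where "l = a * (\<eta>/2)\<^sup>2 * h"
  have l: "l > 0" using a \<eta> h by (simp add: l_def)
  define A where "A = (\<lambda>t. energy (z t)) ` {0..}"
  have A: "A \<noteq> {}" "bdd_below A"
    unfolding A_def by (auto intro!: bdd_belowI[of _ 0] energy_nonneg)
  obtain T where T: "T \<ge> 0" "energy (z T) < Inf A + l"
    using cInf_lessD[OF A(1), of "Inf A + l"] l by (auto simp: A_def)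
  have "\<bar>snd (z t)\<bar> \<le> \<eta>" if t: "t \<ge> T" for t
  proof (rule ccontr)
    assume c: "\<not> \<bar>snd (z t)\<bar> \<le> \<eta>"
    have "(\<eta>/2)\<^sup>2 \<le> (snd (z r))\<^sup>2" if r: "r \<in> {t..t+h}" for r
    proof -
      have "\<bar>snd (z r) - snd (z t)\<bar> \<le> M * (r - t)" using M(2)[of t r] r t T by auto
      also have "\<dots> \<le> M * h" using M(1) r by simp
      finally have "\<eta>/2 \<le> \<bar>snd (z r)\<bar>" using c h by linarith
      then show ?thesis using \<eta> by (metis abs_ge_zero power2_abs power_mono half_gt_zero less_imp_le)
    qed
    then have "energy (z (t + h)) \<le> energy (z t) - l"
      using energy_drop[OF z nz, of t "t + h" "(\<eta>/2)\<^sup>2"] t T h by (simp add: l_def)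
    also have "energy (z t) \<le> energy (z T)" using energy_drop[OF z nz T(1) t, of 0] by simp
    finally have "energy (z (t + h)) < Inf A" using T by simp
    moreover have "Inf A \<le> energy (z (t + h))"
      using t T h by (intro cInf_lower A(2)) (auto simp: A_def)
    ultimately show False by simp
  qed
  then show ?thesis using that T by blast
qed

section \<open>Slow trajectories near the line \<open>x = 0\<close> and near the rest
  distance\<close>

lemma fst_diff_bound:
  assumes z: "solution z" and s: "0 \<le> s" "s \<le> u" and b: "\<And>t. t \<in> {s..u} \<Longrightarrow> \<bar>snd (z t)\<bar> \<le> \<eta>"
  shows "\<bar>fst (z u) - fst (z s)\<bar> \<le> \<eta> * (u - s)"
  using field_differentiable_bound[of "{s..u}" "\<lambda>t. fst (z t)" "\<lambda>t. snd (z t)" \<eta> u s]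
    solution_fst_deriv[OF z s(1)] b s by auto

text \<open>By the mean value theorem some acceleration in the unit interval equals the change of
  velocity, which is small; the equation then puts the position near \<open>D\<close> at that time.
  In the constant, 2 comes from the two end velocities, \<open>a\<close> from friction, and the
  final 1 from the displacement back to \<open>t\<close>. The time \<open>t\<close> itself may be a
  crossing.\<close>

lemma near_rest_distance:
  assumes z: "solution z" and t: "0 \<le> t" and pos: "\<And>r. t < r \<Longrightarrow> r < t + 1 \<Longrightarrow> fst (z r) > 0"
    and b: "\<And>r. r \<in> {t..t+1} \<Longrightarrow> \<bar>snd (z r)\<bar> \<le> \<eta>"
  shows "\<bar>fst (z t) - D\<bar> \<le> ((2 + a) / k + 1) * \<eta>"
proof -
  have at: "at r within {t..t+1} = at r" if "t < r" "r < t + 1" for r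
    using that by (intro at_within_interior) auto
  have der: "((\<lambda>t. snd (z t)) has_real_derivative - a * snd (z r) - k * fst (z r) + k * D) (at r within {t..t+1})"
    if "r \<in> {t..t+1}" for r
    by (rule solution_snd_deriv[OF z t that pos])
  have "\<exists>l r. t < r \<and> r < t + 1 \<and> ((\<lambda>t. snd (z t)) has_real_derivative l) (at r) \<and>
      snd (z (t + 1)) - snd (z t) = (t + 1 - t) * l"
  proof (rule MVT)
    show "continuous_on {t..t+1} (\<lambda>t. snd (z t))"
      by (intro continuous_intros solution_continuous_on z t)
    show "(\<lambda>t. snd (z t)) differentiable (at r)" if "t < r" "r < t + 1" for r
      using der[of r] that at real_differentiable_def by auto
  qed auto
  then obtain l r where r: "t < r" "r < t + 1" "((\<lambda>t. snd (z t)) has_real_derivative l) (at r)"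
    "snd (z (t + 1)) - snd (z t) = l" by auto
  have "l = - a * snd (z r) - k * fst (z r) + k * D"
    using DERIV_unique[OF r(3)] der[of r] at r by auto
  then have "k * (fst (z r) - D) = - a * snd (z r) - (snd (z (t + 1)) - snd (z t))"
    using r(4) by (simp add: algebra_simps)
  then have "\<bar>k * (fst (z r) - D)\<bar> \<le> a * \<bar>snd (z r)\<bar> + \<bar>snd (z (t + 1))\<bar> + \<bar>snd (z t)\<bar>"
    using abs_mult[of a "snd (z r)"] a by linarith
  also have "\<dots> \<le> a * \<eta> + \<eta> + \<eta>"
    using a b[of r] b[of t] b[of "t + 1"] r by (intro add_mono) auto
  also have "\<bar>k * (fst (z r) - D)\<bar> = k * \<bar>fst (z r) - D\<bar>" using k by (simp add: abs_mult)
  finally have "k * \<bar>fst (z r) - D\<bar> \<le> (2 + a) * \<eta>" by (simp add: algebra_simps)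
  then have "\<bar>fst (z r) - D\<bar> \<le> (2 + a) / k * \<eta>" using k by (simp add: field_simps)
  moreover have "\<bar>fst (z r) - fst (z t)\<bar> \<le> \<eta>"
  proof -
    have "\<bar>fst (z r) - fst (z t)\<bar> \<le> \<eta> * (r - t)"
      by (rule fst_diff_bound[OF z t]) (use r b in auto)
    also have "\<dots> \<le> \<eta> * 1" using r b[of t] by (intro mult_left_mono) auto
    finally show ?thesis by simp
  qed
  ultimately show ?thesis by (simp add: algebra_simps)
qed

text \<open>Within unit time a slow solution travels at most \<open>\<eta> < D\<close>, so it
  remains below \<open>D\<close>, where the position increases. A first return to the line would
  contradict this.\<close>

lemma positive_after_slow_crossing:
  assumes z: "solution z" and t: "0 \<le> t" and z0: "fst (z t) = 0" "snd (z t) > 0"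
    and b: "\<And>r. r \<in> {t..t+1} \<Longrightarrow> \<bar>snd (z r)\<bar> \<le> \<eta>" and \<eta>: "\<eta> < D" and r: "t < r" "r \<le> t + 1"
  shows "fst (z r) > 0"
proof (rule ccontr)
  assume neg: "\<not> fst (z r) > 0"
  obtain u where u: "t < u" "\<And>r. t < r \<Longrightarrow> r \<le> u \<Longrightarrow> fst (z r) > 0"
    using positive_after[OF z t] z0 by blast
  \<comment> \<open>The search starts at \<open>u\<close>, not at \<open>t\<close>: the set is then
    compact and the crossing at \<open>t\<close> itself is excluded.\<close>
  define A where "A = {q \<in> {u..t+1}. fst (z q) \<le> 0}"
  have "continuous_on {u..t+1} (\<lambda>t. fst (z t))"
    using u t by (intro continuous_intros solution_continuous_on z) auto
  then have "closed A" unfolding A_def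
    by (intro continuous_on_closed_Collect_le continuous_on_const closed_atLeastAtMost)
  moreover have "bounded A" by (rule bounded_subset[of "{u..t+1}"]) (auto simp: A_def)
  ultimately have "compact A" by (simp add: compact_eq_bounded_closed)
  moreover have "r \<in> A" using neg r u(2)[of r] by (force simp: A_def)
  ultimately obtain q where q: "q \<in> A" "\<And>y. y \<in> A \<Longrightarrow> q \<le> y"
    using compact_attains_inf[of A] by blast
  have tq: "t < q" "q \<le> t + 1" using q(1) u(1) by (auto simp: A_def)
  have pos: "fst (z y) > 0" if "t < y" "y < q" for y
    using u(2)[of y] q(2)[of y] that tq by (force simp: A_def)
  have "fst (z t) < fst (z q)"
  proof (rule strictly_increasing_below_rest_distance[OF tq(1), of "\<lambda>t. fst (z t)" "\<lambda>t. snd (z t)"])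
    show "fst (z y) < D" if y: "t < y" "y < q" for y
    proof -
      have "\<bar>fst (z y) - fst (z t)\<bar> \<le> \<eta> * (y - t)"
        by (rule fst_diff_bound[OF z t]) (use y b tq in auto)
      also have "\<dots> \<le> \<eta> * 1" using y b[of t] tq by (intro mult_left_mono) auto
      finally show ?thesis using \<eta> z0 by simp
    qed
  next
    fix y assume y: "y \<in> {t..q}"
    show "((\<lambda>t. fst (z t)) has_real_derivative snd (z y)) (at y within {t..q})"
      by (rule solution_fst_deriv[OF z t y])
    show "((\<lambda>t. snd (z t)) has_real_derivative - a * snd (z y) - k * fst (z y) + k * D) (at y within {t..q})"
      by (rule solution_snd_deriv[OF z t y pos])
  qed (use z0 in auto)
  then show False using q(1) z0 by (auto simp: A_def)
qed

lemma distance_tendsto: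
  assumes z: "solution z" and nz: "\<And>t. 0 \<le> t \<Longrightarrow> z t \<noteq> 0"
  shows "((\<lambda>t. \<bar>fst (z t)\<bar>) \<longlongrightarrow> D) at_top"
proof (rule tendstoI)
  fix e :: real assume e: "e > 0"
  define C where "C = (2 + a) / k + 1"
  have C: "C > 1" using a k by (simp add: C_def)
  \<comment> \<open>\<open>C * \<eta> < e\<close> gives the final accuracy,
    \<open>C * \<eta> < D\<close> rules out position 0 near the rest distance, and
    \<open>\<eta> < D\<close> is the slowness required after a crossing.\<close>
  define \<eta> where "\<eta> = min e D / (2 * C)"
  have \<eta>: "\<eta> > 0" "C * \<eta> < e" "C * \<eta> < D" using e D C by (auto simp: \<eta>_def)
  have "\<eta> < D" using \<eta> C by (smt (verit) mult_le_cancel_right1)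
  obtain T where T: "T \<ge> 0" "\<And>t. t \<ge> T \<Longrightarrow> \<bar>snd (z t)\<bar> \<le> \<eta>"
    using velocity_tendsto_0[OF z nz \<eta>(1)] by blast
  \<comment> \<open>After a slow upward crossing the position would remain positive for unit time,
    so it would already be within \<open>C * \<eta> < D\<close> of \<open>D\<close> at
    \<open>t\<close>, where it is 0. Downward crossings are treated by reflection.\<close>
  have no_crossing: False if z: "solution z" and b: "\<And>t. t \<ge> T \<Longrightarrow> \<bar>snd (z t)\<bar> \<le> \<eta>"
    and t: "t \<ge> T" and zt: "fst (z t) = 0" "snd (z t) > 0" for z t
  proof -
    have "\<bar>fst (z t) - D\<bar> \<le> C * \<eta>"
      unfolding C_def
    proof (rule near_rest_distance[OF z])
      show "fst (z r) > 0" if "t < r" "r < t + 1" for r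
        by (rule positive_after_slow_crossing[OF z _ zt _ \<open>\<eta> < D\<close>]) (use that T t b in auto)
    qed (use T t b in auto)
    then show False using zt \<eta> D by simp
  qed
  have nonzero: "fst (z t) \<noteq> 0" if "t \<ge> T" for t
  proof
    assume z0: "fst (z t) = 0"
    then have "snd (z t) \<noteq> 0" using nz[of t] that T by (auto simp: prod_eq_iff)
    then show False
      using no_crossing[OF z T(2) that] no_crossing[OF solution_uminus[OF z], of t] T(2) z0 that
      by (cases "snd (z t) > 0") auto
  qed
  have near: "\<bar>fst (z t) - D\<bar> \<le> C * \<eta>"
    if z: "solution z" and b: "\<And>t. t \<ge> T \<Longrightarrow> \<bar>snd (z t)\<bar> \<le> \<eta>" and nonzero: "\<And>t. t \<ge> T \<Longrightarrow> fst (z t) \<noteq> 0"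
      and t: "t \<ge> T" and pos: "fst (z t) > 0" for z t
    unfolding C_def
  proof (rule near_rest_distance[OF z])
    show "fst (z r) > 0" if r: "t < r" "r < t + 1" for r
    proof (rule ccontr)
      assume "\<not> fst (z r) > 0"
      moreover have "continuous_on {t..r} (\<lambda>t. fst (z t))"
        using t T by (intro continuous_intros solution_continuous_on z) auto
      ultimately obtain y where "t \<le> y" "y \<le> r" "fst (z y) = 0"
        using IVT2'[of "\<lambda>t. fst (z t)" r 0 t] pos r by auto
      then show False using nonzero[of y] t by auto
    qed
  qed (use T t b in auto)
  have "dist \<bar>fst (z t)\<bar> D < e" if t: "t \<ge> T" for t
  proof (cases "fst (z t) > 0")
    case True
    then show ?thesis using near[OF z T(2) nonzero t] \<eta> by (simp add: dist_real_def)
  next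
    case False
    then have "fst (- z t) > 0" using nonzero[OF t] by simp
    then have "\<bar>fst (- z t) - D\<bar> \<le> C * \<eta>"
      by (intro near[OF solution_uminus[OF z] _ _ t]) (use T nonzero in auto)
    then show ?thesis using \<eta> False by (simp add: dist_real_def)
  qed
  then show "eventually (\<lambda>t. dist \<bar>fst (z t)\<bar> D < e) at_top"
    unfolding eventually_at_top_linorder by blast
qed

subsection \<open>Existence and non-uniqueness\<close>

text \<open>The linear equation of the side \<open>x > 0\<close>, continued to all positions and all
  times. It describes the system only as long as the position is positive.\<close>

definition is_flow :: "(real \<Rightarrow> real) \<Rightarrow> (real \<Rightarrow> real) \<Rightarrow> bool" where
  "is_flow x v \<longleftrightarrow> (\<forall>t. (x has_real_derivative v t) (at t)) \<and>
     (\<forall>t. (v has_real_derivative - a * v t - k * x t + k * D) (at t))"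

text \<open>The substitution \<open>x = D + exp (- b * t) * p\<close> with \<open>b = a / 2\<close>
  removes the damping and leaves \<open>p'' = - \<sigma> * p\<close>. The coefficients
  \<open>A\<close> and \<open>B\<close> are read off from the initial position and velocity.\<close>

lemma ex_flow:
  obtains x v where "is_flow x v" "x 0 = x0" "v 0 = v0"
proof -
  define b where "b = a / 2"
  define \<sigma> where "\<sigma> = k - b * b"
  obtain c s :: "real \<Rightarrow> real" where cs: "c 0 = 1" "s 0 = 0"
    "\<And>t. (c has_real_derivative - \<sigma> * s t) (at t)" "\<And>t. (s has_real_derivative c t) (at t)"
    using ex_cosine_sine_like by blast
  define A where "A = x0 - D"
  define B where "B = v0 + b * A"
  define p where "p t = A * c t + B * s t" for t
  define q where "q t = B * c t - \<sigma> * A * s t" for t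
  define x where "x t = D + exp (- b * t) * p t" for t
  define v where "v t = exp (- b * t) * (q t - b * p t)" for t
  have p: "(p has_real_derivative q t) (at t)" and q: "(q has_real_derivative - \<sigma> * p t) (at t)" for t
    unfolding p_def q_def by (auto intro!: derivative_eq_intros cs(3,4) simp: algebra_simps)
  have "(x has_real_derivative v t) (at t)" for t
    unfolding x_def v_def by (auto intro!: derivative_eq_intros p simp: algebra_simps)
  moreover have "(v has_real_derivative - a * v t - k * x t + k * D) (at t)" for t
  proof -
    have "(v has_real_derivative exp (- b * t) * (- b) * (q t - b * p t)
        + exp (- b * t) * (- \<sigma> * p t - b * q t)) (at t)"
      unfolding v_def by (auto intro!: derivative_eq_intros p q simp: algebra_simps)
    moreover have "a = 2 * b" by (simp add: b_def)
    ultimately show ?thesis by (simp add: v_def x_def \<sigma>_def algebra_simps)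
  qed
  moreover have "x 0 = x0" "v 0 = v0" by (simp_all add: x_def v_def p_def q_def cs A_def B_def)
  ultimately show ?thesis using that by (auto simp: is_flow_def)
qed

text \<open>The potential uses \<open>x - D\<close> without absolute value, so the decay persists
  for the linear flow at negative positions. It agrees with \<open>energy\<close> where the position
  is nonnegative.\<close>

lemma flow_energy_le:
  assumes fl: "is_flow x v" and t: "0 \<le> t"
  shows "(v t)\<^sup>2 / 2 + k / 2 * (x t - D)\<^sup>2 \<le> (v 0)\<^sup>2 / 2 + k / 2 * (x 0 - D)\<^sup>2"
proof (rule DERIV_nonpos_imp_nonincreasing[OF t, of "\<lambda>t. (v t)\<^sup>2 / 2 + k / 2 * (x t - D)\<^sup>2"])
  fix r
  have x: "(x has_real_derivative v r) (at r)"
    and v: "(v has_real_derivative - a * v r - k * x r + k * D) (at r)"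
    using fl by (auto simp: is_flow_def)
  have "((\<lambda>t. (v t)\<^sup>2 / 2 + k / 2 * (x t - D)\<^sup>2) has_real_derivative - a * (v r)\<^sup>2) (at r)"
    by (auto intro!: derivative_eq_intros x v simp: power2_eq_square field_simps)
  moreover have "- a * (v r)\<^sup>2 \<le> 0" using a by simp
  ultimately show "\<exists>y. ((\<lambda>t. (v t)\<^sup>2 / 2 + k / 2 * (x t - D)\<^sup>2) has_real_derivative y) (at r) \<and> y \<le> 0"
    by blast
qed

text \<open>The exceptional set is countable, so that gluing arcs needs no transport of null sets.\<close>

definition lipschitz_arc :: "real \<Rightarrow> (real \<Rightarrow> real \<times> real) \<Rightarrow> bool" where
  "lipschitz_arc T w \<longleftrightarrow> (\<exists>L. L-lipschitz_on {0..T} w) \<and>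
     (\<exists>C. countable C \<and> (\<forall>t\<in>{0<..<T} - C. \<exists>d\<in>velocities (w t). (w has_vector_derivative d) (at t)))"

section \<open>Restriction, reflection and gluing of arcs\<close>

lemma arc_mono:
  assumes "lipschitz_arc T w" "S \<le> T"
  shows "lipschitz_arc S w"
proof -
  have "{0..S} \<subseteq> {0..T}" using assms(2) by auto
  moreover have "{0<..<S} - C \<subseteq> {0<..<T} - C" for C using assms(2) by auto
  ultimately show ?thesis
    using assms(1) lipschitz_on_subset unfolding lipschitz_arc_def by (meson subsetD)
qed

lemma arc_cong:
  assumes w: "lipschitz_arc T w" and eq: "\<And>t. 0 \<le> t \<Longrightarrow> t \<le> T \<Longrightarrow> z t = w t"
  shows "lipschitz_arc T z"
proof -
  obtain L C where L: "L-lipschitz_on {0..T} w" and C: "countable C"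
    "\<And>t. t \<in> {0<..<T} - C \<Longrightarrow> \<exists>d\<in>velocities (w t). (w has_vector_derivative d) (at t)"
    using w by (auto simp: lipschitz_arc_def)
  have "L-lipschitz_on {0..T} z"
    using lipschitz_on_transform[OF L] eq by auto
  moreover have "\<exists>d\<in>velocities (z t). (z has_vector_derivative d) (at t)" if t: "t \<in> {0<..<T} - C" for t
  proof -
    obtain d where d: "d \<in> velocities (w t)" "(w has_vector_derivative d) (at t)" using C(2)[OF t] by blast
    have "(z has_vector_derivative d) (at t)"
      by (rule has_vector_derivative_transform_within_open[OF d(2), of "{0<..<T}"]) (use t eq in auto)
    then show ?thesis using d(1) eq[of t] t by auto
  qed
  ultimately show ?thesis using C(1) unfolding lipschitz_arc_def by blast
qed

lemma arc_uminus:
  assumes "lipschitz_arc T w"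
  shows "lipschitz_arc T (\<lambda>t. - w t)"
proof -
  obtain L C where L: "L-lipschitz_on {0..T} w" and C: "countable C"
    "\<And>t. t \<in> {0<..<T} - C \<Longrightarrow> \<exists>d\<in>velocities (w t). (w has_vector_derivative d) (at t)"
    using assms by (auto simp: lipschitz_arc_def)
  have "L-lipschitz_on {0..T} (\<lambda>t. - w t)" using L by (simp add: lipschitz_on_def dist_minus)
  moreover have "\<exists>d\<in>velocities (- w t). ((\<lambda>t. - w t) has_vector_derivative d) (at t)"
    if "t \<in> {0<..<T} - C" for t
    using C(2)[OF that] has_vector_derivative_minus uminus_mem_velocities by blast
  ultimately show ?thesis using C(1) unfolding lipschitz_arc_def by blast
qed

lemma arc_concat_at:
  assumes w: "lipschitz_arc S w" and u: "lipschitz_arc T u" and S: "0 \<le> S" and eq: "u 0 = w S"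
  shows "lipschitz_arc (S + T) (concat_at S w u)"
proof -
  obtain L C where L: "L-lipschitz_on {0..S} w" and C: "countable C"
    "\<And>t. t \<in> {0<..<S} - C \<Longrightarrow> \<exists>d\<in>velocities (w t). (w has_vector_derivative d) (at t)"
    using w by (auto simp: lipschitz_arc_def)
  obtain M C' where M: "M-lipschitz_on {0..T} u" and C': "countable C'"
    "\<And>t. t \<in> {0<..<T} - C' \<Longrightarrow> \<exists>d\<in>velocities (u t). (u has_vector_derivative d) (at t)"
    using u by (auto simp: lipschitz_arc_def)
  have "M-lipschitz_on {S..S+T} (\<lambda>t. u (t - S))"
  proof (rule lipschitz_onI)
    fix x y assume "x \<in> {S..S+T}" "y \<in> {S..S+T}"
    then show "dist (u (x - S)) (u (y - S)) \<le> M * dist x y"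
      using lipschitz_onD[OF M, of "x - S" "y - S"] by (auto simp: dist_real_def)
  qed (use M lipschitz_on_nonneg in blast)
  then have "(max L M)-lipschitz_on {0..S+T} (concat_at S w u)"
    unfolding concat_at_def by (intro lipschitz_on_concat_max L) (auto simp: eq)
  \<comment> \<open>Beyond the two given exceptional sets, the second one shifted, the gluing time
    \<open>S\<close> is excluded, since the derivative may jump there.\<close>
  moreover have "countable (C \<union> (\<lambda>t. t + S) ` C' \<union> {S})" using C(1) C'(1) by auto
  moreover have "\<exists>d\<in>velocities (concat_at S w u t). (concat_at S w u has_vector_derivative d) (at t)"
    if t: "t \<in> {0<..<S+T} - (C \<union> (\<lambda>t. t + S) ` C' \<union> {S})" for t
  proof (cases "t < S")
    case True
    then obtain d where d: "d \<in> velocities (w t)" "(w has_vector_derivative d) (at t)"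
      using C(2)[of t] t by auto
    have "(concat_at S w u has_vector_derivative d) (at t)"
      by (rule has_vector_derivative_transform_within_open[OF d(2), of "{..<S}"])
         (use True in \<open>auto simp: concat_at_def\<close>)
    then show ?thesis using d True by (auto simp: concat_at_def)
  next
    case False
    then have tS: "t > S" using t by auto
    have "t - S \<notin> C'" using t by force
    then obtain d where d: "d \<in> velocities (u (t - S))" "(u has_vector_derivative d) (at (t - S))"
      using C'(2)[of "t - S"] t tS by auto
    have "((\<lambda>t. t - S) has_vector_derivative 1) (at t)" by (auto intro!: derivative_eq_intros)
    then have "((\<lambda>t. u (t - S)) has_vector_derivative d) (at t)"
      using vector_diff_chain_at[of "\<lambda>t. t - S" 1 t u d] d(2) by (simp add: o_def)
    then have "(concat_at S w u has_vector_derivative d) (at t)"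
      by (rule has_vector_derivative_transform_within_open[of _ _ _ "{S<..}"])
         (use tS in \<open>auto simp: concat_at_def\<close>)
    then show ?thesis using d tS by (auto simp: concat_at_def)
  qed
  ultimately show ?thesis unfolding lipschitz_arc_def by blast
qed

lemma arcs_concat_at:
  assumes w: "lipschitz_arc S w" and u: "\<And>T. lipschitz_arc T u" and S: "0 \<le> S" and eq: "u 0 = w S"
  shows "lipschitz_arc T (concat_at S w u)"
  using arc_mono[OF arc_concat_at[OF w u S eq, of "T - S"], of T] by simp

lemma arcs_imp_solution:
  assumes w: "\<And>T. lipschitz_arc T w"
  shows "solution w"
  unfolding solution_def
proof (intro conjI allI impI)
  show "abs_continuous_on 0 T w" for T
    using w[of T] by (auto simp: lipschitz_arc_def intro: lipschitz_on_imp_abs_continuous_on)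
  have "\<forall>n. \<exists>C. countable C \<and> (\<forall>t\<in>{0<..<real n} - C. \<exists>d\<in>velocities (w t). (w has_vector_derivative d) (at t))"
    using w by (auto simp: lipschitz_arc_def)
  then obtain C where C: "\<And>n. countable (C n)"
    "\<And>n t. t \<in> {0<..<real n} - C n \<Longrightarrow> \<exists>d\<in>velocities (w t). (w has_vector_derivative d) (at t)"
    by metis
  \<comment> \<open>Time 0 is added because arcs are differentiated only at interior times.\<close>
  have "countable (insert 0 (\<Union>n. C n))" using C(1) by auto
  then have "insert 0 (\<Union>n. C n) \<in> null_sets lebesgue"
    by (intro null_sets_completionI countable_imp_null_set_lborel)
  then have "AE t in lebesgue. t \<notin> insert 0 (\<Union>n. C n)" by (rule AE_not_in)
  then show "AE t in lebesgue. t \<ge> 0 \<longrightarrow> (\<exists>d. (w has_vector_derivative d) (at t) \<and> d \<in> velocities (w t))"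
  proof eventually_elim
    case (elim t)
    obtain n where "t < real n" using reals_Archimedean2 by blast
    then have "t \<ge> 0 \<Longrightarrow> t \<in> {0<..<real n} - C n" using elim by auto
    then show ?case using C(2)[of t n] by blast
  qed
qed

lemma flow_arc:
  assumes fl: "is_flow x v" and pos: "\<And>t. 0 < t \<Longrightarrow> t < T \<Longrightarrow> x t > 0"
  shows "lipschitz_arc T (\<lambda>t. (x t, v t))"
proof -
  have x: "(x has_real_derivative v t) (at t)"
    and v: "(v has_real_derivative - a * v t - k * x t + k * D) (at t)" for t
    using fl by (auto simp: is_flow_def)
  have xv: "((\<lambda>t. (x t, v t)) has_vector_derivative velocity 1 (x t, v t)) (at t)" for t
    unfolding velocity_def
    using x[of t] v[of t] by (auto intro!: has_vector_derivative_Pair simp: has_real_derivative_iff_has_vector_derivative)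
  have "continuous_on {0..T} x" "continuous_on {0..T} v"
    using x v by (meson DERIV_isCont continuous_at_imp_continuous_on)+
  then have "continuous_on {0..T} (\<lambda>t. velocity 1 (x t, v t))"
    unfolding velocity_def by (auto intro!: continuous_intros)
  then obtain L where "L-lipschitz_on {0..T} (\<lambda>t. (x t, v t))"
    using continuous_deriv_imp_lipschitz_on[of 0 T "\<lambda>t. (x t, v t)" "\<lambda>t. velocity 1 (x t, v t)"] xv
    by (auto intro: has_vector_derivative_at_within)
  moreover have "\<exists>d\<in>velocities (x t, v t). ((\<lambda>t. (x t, v t)) has_vector_derivative d) (at t)"
    if "t \<in> {0<..<T} - {}" for t
    using xv[of t] pos[of t] that velocities_pos[of "(x t, v t)"] by auto
  ultimately show ?thesis unfolding lipschitz_arc_def by (meson countable_empty)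
qed

text \<open>The energy bound limits the speed to \<open>V\<close>, so the flow stays below
  \<open>D\<close> before the time \<open>D / V\<close>; there the position increases and remains
  positive. For \<open>p = 0\<close> the case distinction selects the side \<open>x > 0\<close>, and
  the last clause shows that the origin is left at once.\<close>

lemma segment_from_crossing:
  assumes V: "V > 0" and p: "fst p = 0" "energy p \<le> V\<^sup>2 / 2"
  shows "\<exists>w. w 0 = p \<and> lipschitz_arc (D / V) w \<and> (\<forall>t. 0 \<le> t \<longrightarrow> t \<le> D / V \<longrightarrow> energy (w t) \<le> V\<^sup>2 / 2) \<and>
      (\<forall>t. 0 < t \<longrightarrow> t \<le> D / V \<longrightarrow> w t \<noteq> 0)"
proof -
  have up: "\<exists>w. w 0 = p \<and> lipschitz_arc (D / V) w \<and> (\<forall>t. 0 \<le> t \<longrightarrow> t \<le> D / V \<longrightarrow> energy (w t) \<le> V\<^sup>2 / 2) \<and>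
      (\<forall>t. 0 < t \<longrightarrow> t \<le> D / V \<longrightarrow> w t \<noteq> 0)"
    if p: "fst p = 0" "snd p \<ge> 0" "energy p \<le> V\<^sup>2 / 2" for p
  proof -
    obtain x v where fl: "is_flow x v" "x 0 = 0" "v 0 = snd p" using ex_flow by blast
    have x: "(x has_real_derivative v t) (at t)"
      and v: "(v has_real_derivative - a * v t - k * x t + k * D) (at t)" for t
      using fl by (auto simp: is_flow_def)
    have E: "(v t)\<^sup>2 / 2 + k / 2 * (x t - D)\<^sup>2 \<le> V\<^sup>2 / 2" if "0 \<le> t" for t
      using flow_energy_le[OF fl(1) that] p fl by (simp add: energy_def)
    have vV: "\<bar>v t\<bar> \<le> V" if "0 \<le> t" for t
    proof -
      have "k / 2 * (x t - D)\<^sup>2 \<ge> 0" using k by simp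
      then have "(v t)\<^sup>2 \<le> V\<^sup>2" using E[OF that] by simp
      then show ?thesis using V abs_le_square_iff[of "v t" V] by simp
    qed
    have xV: "x t \<le> V * t" if "0 \<le> t" for t
      using field_differentiable_bound[of "{0..t}" x v V t 0] vV that fl(2)
        has_field_derivative_at_within[OF x] by auto
    have pos: "x t > 0" if t: "0 < t" "t \<le> D / V" for t
    proof -
      have "x 0 < x t"
      proof (rule strictly_increasing_below_rest_distance[OF t(1)])
        fix r assume r: "0 < r" "r < t"
        have "x r \<le> V * r" using xV r by simp
        also have "\<dots> < V * (D / V)" using r t V by (intro mult_strict_left_mono) auto
        finally show "x r < D" using V by simp
      next
        fix r
        show "(x has_real_derivative v r) (at r within {0..t})" by (rule has_field_derivative_at_within[OF x])
        show "(v has_real_derivative - a * v r - k * x r + k * D) (at r within {0..t})"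
          by (rule has_field_derivative_at_within[OF v])
      qed (use fl p in simp)
      then show ?thesis using fl by simp
    qed
    have "energy (x t, v t) \<le> V\<^sup>2 / 2" if "0 \<le> t" "t \<le> D / V" for t
      using E[OF that(1)] pos[of t] that fl(2) by (cases "t = 0") (auto simp: energy_def)
    moreover have "lipschitz_arc (D / V) (\<lambda>t. (x t, v t))" by (rule flow_arc[OF fl(1)]) (use pos in auto)
    moreover have "(x 0, v 0) = p" using fl p by (simp add: prod_eq_iff)
    moreover have "(x t, v t) \<noteq> 0" if "0 < t" "t \<le> D / V" for t
      using pos[OF that] by (simp add: zero_prod_def)
    ultimately show ?thesis by (intro exI[of _ "\<lambda>t. (x t, v t)"]) auto
  qed
  show ?thesis
  proof (cases "snd p \<ge> 0")
    case True
    then show ?thesis using up[of p] p by blast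
  next
    case False
    then obtain w where w: "w 0 = - p" "lipschitz_arc (D / V) w" "\<forall>t. 0 \<le> t \<longrightarrow> t \<le> D / V \<longrightarrow> energy (w t) \<le> V\<^sup>2 / 2"
      "\<forall>t. 0 < t \<longrightarrow> t \<le> D / V \<longrightarrow> w t \<noteq> 0"
      using up[of "- p"] p by auto
    show ?thesis
      by (rule exI[of _ "\<lambda>t. - w t"]) (use w arc_uminus in auto)
  qed
qed

text \<open>The flow is followed up to its first zero, if there is one in time, and continued from
  that crossing. The continuation lasts for the full time \<open>D / V\<close>, so no second
  crossing arises. The energy bound holds again at the end, so the step can be iterated with
  constant length.\<close>

lemma segment:
  assumes V: "V > 0" and p: "energy p \<le> V\<^sup>2 / 2"
  obtains w where "w 0 = p" "lipschitz_arc (D / V) w" "energy (w (D / V)) \<le> V\<^sup>2 / 2"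
proof -
  have \<tau>: "D / V > 0" using D V by simp
  have right: "\<exists>w. w 0 = p \<and> lipschitz_arc (D / V) w \<and> energy (w (D / V)) \<le> V\<^sup>2 / 2"
    if p: "fst p > 0" "energy p \<le> V\<^sup>2 / 2" for p
  proof -
    obtain x v where fl: "is_flow x v" "x 0 = fst p" "v 0 = snd p" using ex_flow by blast
    have x: "(x has_real_derivative v t) (at t)" for t
      using fl by (auto simp: is_flow_def)
    have E: "energy (x t, v t) \<le> V\<^sup>2 / 2" if "0 \<le> t" "0 \<le> x t" for t
      using flow_energy_le[OF fl(1) that(1)] that p fl by (simp add: energy_def)
    show ?thesis
    proof (cases "\<forall>t. 0 \<le> t \<longrightarrow> t \<le> D / V \<longrightarrow> x t > 0")
      case True
      then have "lipschitz_arc (D / V) (\<lambda>t. (x t, v t))" by (intro flow_arc[OF fl(1)]) auto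
      moreover have "energy (x (D / V), v (D / V)) \<le> V\<^sup>2 / 2" using True \<tau> by (intro E) (auto simp: less_imp_le)
      ultimately show ?thesis using fl by (intro exI[of _ "\<lambda>t. (x t, v t)"]) simp
    next
      case False
      define A where "A = {t \<in> {0..D / V}. x t \<le> 0}"
      have "continuous_on {0..D / V} x" using x by (meson DERIV_isCont continuous_at_imp_continuous_on)
      then have "closed A" unfolding A_def
        by (intro continuous_on_closed_Collect_le continuous_on_const closed_atLeastAtMost)
      moreover have "bounded A" by (rule bounded_subset[of "{0..D / V}"]) (auto simp: A_def)
      ultimately have "compact A" by (simp add: compact_eq_bounded_closed)
      moreover have "A \<noteq> {}" using False by (force simp: A_def)
      ultimately obtain q where q: "q \<in> A" "\<And>y. y \<in> A \<Longrightarrow> q \<le> y"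
        using compact_attains_inf[of A] by blast
      have q0: "0 \<le> q" "q \<le> D / V" "x q \<le> 0" using q(1) by (auto simp: A_def)
      have pos: "x t > 0" if "0 \<le> t" "t < q" for t
        using q(2)[of t] that q0 by (force simp: A_def)
      have xq: "x q = 0"
      proof (rule ccontr)
        assume "x q \<noteq> 0"
        moreover have "continuous_on {0..q} x" using x by (meson DERIV_isCont continuous_at_imp_continuous_on)
        ultimately obtain y where "0 \<le> y" "y \<le> q" "x y = 0"
          using IVT2'[of x q 0 0] q0 p fl by auto
        then show False using pos[of y] \<open>x q \<noteq> 0\<close> by (cases "y = q") auto
      qed
      have fst_xq: "fst (x q, v q) = 0" using xq by simp
      have Eq: "energy (x q, v q) \<le> V\<^sup>2 / 2" using xq q0 by (intro E) auto
      obtain u where u: "u 0 = (x q, v q)" "lipschitz_arc (D / V) u"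
        "\<And>t. 0 \<le> t \<Longrightarrow> t \<le> D / V \<Longrightarrow> energy (u t) \<le> V\<^sup>2 / 2"
        "\<And>t. 0 < t \<Longrightarrow> t \<le> D / V \<Longrightarrow> u t \<noteq> 0"
        using segment_from_crossing[OF V fst_xq Eq] by blast
      define w where "w = concat_at q (\<lambda>t. (x t, v t)) u"
      have "lipschitz_arc q (\<lambda>t. (x t, v t))" by (rule flow_arc[OF fl(1)]) (use pos in auto)
      \<comment> \<open>The glued arc overshoots to \<open>q + D / V\<close> and is then cut
        back.\<close>
      then have "lipschitz_arc (q + D / V) w" unfolding w_def using u q0 by (intro arc_concat_at) auto
      then have "lipschitz_arc (D / V) w" by (rule arc_mono) (use q0 in simp)
      moreover have "energy (w (D / V)) \<le> V\<^sup>2 / 2"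
      proof (cases "q = D / V")
        case True
        then show ?thesis using E[of q] xq q0 by (simp add: w_def concat_at_def)
      next
        case False
        then show ?thesis using u(3)[of "D / V - q"] q0 by (simp add: w_def concat_at_def)
      qed
      moreover have "w 0 = p" using q0 fl by (simp add: w_def concat_at_def)
      ultimately show ?thesis by blast
    qed
  qed
  consider "fst p = 0" | "fst p > 0" | "fst p < 0" by linarith
  then show ?thesis
  proof cases
    case 1
    obtain w where w: "w 0 = p" "lipschitz_arc (D / V) w" "\<And>t. 0 \<le> t \<Longrightarrow> t \<le> D / V \<Longrightarrow> energy (w t) \<le> V\<^sup>2 / 2"
        "\<And>t. 0 < t \<Longrightarrow> t \<le> D / V \<Longrightarrow> w t \<noteq> 0"
      using segment_from_crossing[OF V 1 p] by blast
    show ?thesis by (rule that[OF w(1,2)]) (use w(3) \<tau> in simp)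
  next
    case 2
    then obtain w where "w 0 = p" "lipschitz_arc (D / V) w" "energy (w (D / V)) \<le> V\<^sup>2 / 2"
      using right[of p] p by blast
    then show ?thesis by (rule that)
  next
    case 3
    then obtain w where "w 0 = - p" "lipschitz_arc (D / V) w" "energy (w (D / V)) \<le> V\<^sup>2 / 2"
      using right[of "- p"] p by auto
    then show ?thesis by (intro that[of "\<lambda>t. - w t"] arc_uminus) simp_all
  qed
qed

lemma ex_arcs:
  obtains w where "w 0 = p" "\<And>T. lipschitz_arc T w"
proof -
  \<comment> \<open>The summand 1 makes \<open>V\<close> positive even for a start with zero
    energy.\<close>
  define V where "V = sqrt (2 * energy p) + 1"
  have V: "V > 0" using energy_nonneg[of p] by (simp add: V_def add_nonneg_pos)
  have "(sqrt (2 * energy p))\<^sup>2 \<le> V\<^sup>2" by (rule power_mono) (auto simp: V_def energy_nonneg)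
  then have pV: "energy p \<le> V\<^sup>2 / 2" using energy_nonneg[of p] by simp
  define \<tau> where "\<tau> = D / V"
  have \<tau>: "\<tau> > 0" using D V by (simp add: \<tau>_def)
  \<comment> \<open>Arcs on growing intervals, each extending the previous one. The energy bound is
    the invariant that allows the same step length \<open>\<tau>\<close> at every stage.\<close>
  have "\<exists>f. \<forall>n. (f n 0 = p \<and> lipschitz_arc (real n * \<tau>) (f n) \<and> energy (f n (real n * \<tau>)) \<le> V\<^sup>2 / 2) \<and>
      (\<forall>t. t \<le> real n * \<tau> \<longrightarrow> f (Suc n) t = f n t)"
  proof (rule dependent_nat_choice)
    have "lipschitz_arc 0 (\<lambda>_. p)"
      unfolding lipschitz_arc_def by (auto intro!: exI[of _ "{}"] exI[of _ 0] lipschitz_onI)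
    then show "\<exists>w. w 0 = p \<and> lipschitz_arc (real 0 * \<tau>) w \<and> energy (w (real 0 * \<tau>)) \<le> V\<^sup>2 / 2"
      using pV by (intro exI[of _ "\<lambda>_. p"]) simp
  next
    fix w n assume w: "w 0 = p \<and> lipschitz_arc (real n * \<tau>) w \<and> energy (w (real n * \<tau>)) \<le> V\<^sup>2 / 2"
    then obtain u where u: "u 0 = w (real n * \<tau>)" "lipschitz_arc \<tau> u" "energy (u \<tau>) \<le> V\<^sup>2 / 2"
      using segment[OF V] unfolding \<tau>_def by metis
    define w' where "w' = concat_at (real n * \<tau>) w u"
    have n\<tau>: "real n * \<tau> \<ge> 0" "real n * \<tau> + \<tau> = real (Suc n) * \<tau>" using \<tau> by (auto simp: algebra_simps)
    have "lipschitz_arc (real (Suc n) * \<tau>) w'"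
      using arc_concat_at[of "real n * \<tau>" w \<tau> u] w u n\<tau> by (simp add: w'_def)
    moreover have "w' 0 = p" using w n\<tau> by (simp add: w'_def concat_at_def)
    moreover have "w' (real (Suc n) * \<tau>) = u \<tau>" using \<tau> by (simp add: w'_def concat_at_def algebra_simps)
    ultimately show "\<exists>w'. (w' 0 = p \<and> lipschitz_arc (real (Suc n) * \<tau>) w' \<and> energy (w' (real (Suc n) * \<tau>)) \<le> V\<^sup>2 / 2) \<and>
        (\<forall>t. t \<le> real n * \<tau> \<longrightarrow> w' t = w t)"
      using u(3) by (intro exI[of _ w']) (simp add: w'_def concat_at_def)
  qed
  then obtain f where f: "\<And>n. f n 0 = p" "\<And>n. lipschitz_arc (real n * \<tau>) (f n)"
    "\<And>n t. t \<le> real n * \<tau> \<Longrightarrow> f (Suc n) t = f n t" by blast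
  have agree: "f m t = f n t" if "n \<le> m" "t \<le> real n * \<tau>" for m n t
    using that(1)
  proof (induction rule: dec_induct)
    case (step m)
    have "t \<le> real m * \<tau>" using that(2) step(1) \<tau> by (meson mult_right_mono of_nat_mono order_trans less_imp_le)
    then show ?case using f(3) step by simp
  qed simp
  \<comment> \<open>The index of a stage whose interval already contains \<open>t\<close>.\<close>
  define N where "N t = nat \<lceil>t / \<tau>\<rceil>" for t
  have N: "t \<le> real (N t) * \<tau>" for t
  proof -
    have "t / \<tau> \<le> real (N t)" unfolding N_def by linarith
    then show ?thesis using \<tau> by (simp add: field_simps)
  qed
  define w where "w t = f (N t) t" for t
  have "lipschitz_arc T w" for T
  proof (rule arc_cong[OF arc_mono[OF f(2) N[of T]]])
    fix t assume "0 \<le> t" "t \<le> T"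
    then have "t / \<tau> \<le> T / \<tau>" using \<tau> by (simp add: divide_right_mono)
    then have "N t \<le> N T" unfolding N_def by (intro nat_mono ceiling_mono)
    then show "w t = f (N T) t" unfolding w_def using agree[of "N t" "N T" t] N by simp
  qed
  moreover have "w 0 = p" by (simp add: w_def f)
  ultimately show ?thesis using that by blast
qed

lemma ex_arcs_leaving_0:
  obtains w e where "w 0 = 0" "\<And>T. lipschitz_arc T w" "e > 0" "\<And>t. 0 < t \<Longrightarrow> t \<le> e \<Longrightarrow> w t \<noteq> 0"
proof -
  \<comment> \<open>This value makes \<open>V\<^sup>2 / 2\<close> equal to the energy of the
    origin.\<close>
  define V where "V = sqrt (k * D\<^sup>2)"
  have V: "V > 0" "energy 0 \<le> V\<^sup>2 / 2" using k D by (simp_all add: V_def energy_def)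
  obtain u where u: "u 0 = 0" "lipschitz_arc (D / V) u" "\<And>t. 0 \<le> t \<Longrightarrow> t \<le> D / V \<Longrightarrow> energy (u t) \<le> V\<^sup>2 / 2"
      "\<And>t. 0 < t \<Longrightarrow> t \<le> D / V \<Longrightarrow> u t \<noteq> 0"
    using segment_from_crossing[OF V(1) fst_zero V(2)] by blast
  obtain w where w: "w 0 = u (D / V)" "\<And>T. lipschitz_arc T w" using ex_arcs by blast
  have DV: "D / V > 0" using D V by simp
  show ?thesis
  proof (rule that[OF _ _ DV])
    show "concat_at (D / V) u w 0 = 0" using DV u(1) by (simp add: concat_at_def)
    show "lipschitz_arc T (concat_at (D / V) u w)" for T
      by (rule arcs_concat_at[OF u(2) w(2) _ w(1)]) (use DV in simp)
    show "concat_at (D / V) u w t \<noteq> 0" if "0 < t" "t \<le> D / V" for t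
      using u(4)[OF that] that(2) by (simp add: concat_at_def)
  qed
qed

text \<open>The choice \<open>u = 0\<close> makes the origin an equilibrium of the inclusion, so a
  solution may rest there.\<close>

lemma arc_const_0: "lipschitz_arc T (\<lambda>_. 0)"
proof -
  have "(0::real\<times>real) \<in> velocities 0"
    unfolding velocities_def velocity_def by (auto simp: zero_prod_def intro!: exI[of _ 0])
  moreover have "((\<lambda>_. 0) has_vector_derivative (0::real\<times>real)) (at t)" for t by simp
  moreover have "0-lipschitz_on {0..T} (\<lambda>_. (0::real\<times>real))" by (rule lipschitz_onI) auto
  ultimately show ?thesis unfolding lipschitz_arc_def by (meson countable_empty)
qed

text \<open>A solution that reaches the origin may rest there for any time \<open>s\<close> before leaving it.\<close>

lemma infinitely_many_solutions:
  assumes g: "\<And>T. lipschitz_arc T g" and T: "0 \<le> T" "g T = 0"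
  shows "infinite ((\<lambda>z. restrict z {0..}) ` {z. solution z \<and> z 0 = g 0})"
proof -
  obtain y e where y: "y 0 = 0" "\<And>T. lipschitz_arc T y" "e > 0" "\<And>t. 0 < t \<Longrightarrow> t \<le> e \<Longrightarrow> y t \<noteq> 0"
    using ex_arcs_leaving_0 by blast
  define w where "w s = concat_at T g (concat_at s (\<lambda>_. 0) y)" for s
  have sol: "solution (w s) \<and> w s 0 = g 0" if s: "0 \<le> s" for s
  proof
    have "lipschitz_arc S (concat_at s (\<lambda>_. 0) y)" for S by (rule arcs_concat_at[OF arc_const_0 y(2) s y(1)])
    then have "lipschitz_arc S (w s)" for S
      unfolding w_def by (rule arcs_concat_at[OF g _ T(1)]) (use T s in \<open>simp add: concat_at_def\<close>)
    then show "solution (w s)" by (rule arcs_imp_solution)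
    show "w s 0 = g 0" using T by (simp add: w_def concat_at_def)
  qed
  have neq: "restrict (w s) {0..} \<noteq> restrict (w s') {0..}" if s: "0 \<le> s" "s < s'" for s s'
  proof
    assume eq: "restrict (w s) {0..} = restrict (w s') {0..}"
    \<comment> \<open>At time \<open>T + s + d\<close> the solution with waiting time
      \<open>s\<close> has just left the origin, while the one with waiting time \<open>s'\<close>
      is still there.\<close>
    define d where "d = min e (s' - s)"
    have d: "0 < d" "d \<le> e" "s + d \<le> s'" using y(3) s by (auto simp: d_def)
    have "w s (T + s + d) = y d" "w s' (T + s + d) = 0"
      using d s by (auto simp: w_def concat_at_def)
    moreover have "w s (T + s + d) = w s' (T + s + d)"
      using fun_cong[OF eq, of "T + s + d"] d s T by simp
    ultimately show False using y(4)[of d] d by simp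
  qed
  have "inj_on (\<lambda>s. restrict (w s) {0..}) {0..}"
  proof (rule inj_onI, rule ccontr)
    fix s s' :: real assume "s \<in> {0..}" "s' \<in> {0..}" "restrict (w s) {0..} = restrict (w s') {0..}" "s \<noteq> s'"
    then show False using neq[of s s'] neq[of s' s] by (cases "s < s'") auto
  qed
  then have "infinite ((\<lambda>s. restrict (w s) {0..}) ` {0..})"
    using finite_imageD infinite_Ici by blast
  moreover have "(\<lambda>s. restrict (w s) {0..}) ` {0..} \<subseteq> (\<lambda>z. restrict z {0..}) ` {z. solution z \<and> z 0 = g 0}"
    using sol by auto
  ultimately show ?thesis using finite_subset by blast
qed

end

text \<open>Solutions are compared after restriction to nonnegative times: values at negative times
  are unconstrained and would destroy uniqueness.\<close>

theorem theorem4p3: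
  fixes \<kappa>0 \<kappa>1 \<kappa>2 dinf x0 v0 :: real
    and Z :: "real \<times> real \<Rightarrow> real \<times> real"
  assumes "\<kappa>0 > 0" "\<kappa>1 > 0" "\<kappa>2 > 0" "dinf > 0"
    and Z_def: "\<And>x v. x \<noteq> 0 \<Longrightarrow>
       Z (x, v) = (v, - \<kappa>0 * (x / \<bar>x\<bar>)\<^sup>2 * v - \<kappa>1 * (x / \<bar>x\<bar>)\<^sup>2 * v
                      - \<kappa>2 * (\<bar>x\<bar> - dinf) * (x / \<bar>x\<bar>))"
    and "(x0, v0) \<noteq> (0, 0)"
  defines "Sol \<equiv> (\<lambda>z. restrict z {0..}) ` {z. filippov_solution Z z \<and> z 0 = (x0, v0)}"
  shows "((\<exists>!z. z \<in> Sol) \<longleftrightarrow> (\<exists>z\<in>Sol. \<forall>t\<ge>0. z t \<noteq> (0, 0)))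
       \<and> (\<not> (\<exists>z\<in>Sol. \<forall>t\<ge>0. z t \<noteq> (0, 0)) \<longrightarrow> infinite Sol)
       \<and> (\<forall>z\<in>Sol. (\<forall>t\<ge>0. z t \<noteq> (0, 0)) \<longrightarrow>
            ((\<lambda>t. \<bar>fst (z t)\<bar>) \<longlongrightarrow> dinf) at_top)"
proof -
  interpret bonding "\<kappa>0 + \<kappa>1" \<kappa>2 dinf by unfold_locales (use assms in auto)
  have "Z (x, v) = velocity (sgn x) (x, v)" if "x \<noteq> 0" for x v
    using that by (simp add: Z_def velocity_def sgn_if algebra_simps)
  then have Sol: "Sol = (\<lambda>z. restrict z {0..}) ` {z. solution z \<and> z 0 = (x0, v0)}"
    by (simp add: Sol_def filippov_solution_iff_solution)
  have unique: "w = z" if z: "z \<in> Sol" "\<forall>t\<ge>0. z t \<noteq> (0, 0)" and w: "w \<in> Sol" for z w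
  proof -
    obtain z' where z': "z = restrict z' {0..}" "solution z'" "z' 0 = (x0, v0)" using z(1) unfolding Sol by blast
    obtain w' where w': "w = restrict w' {0..}" "solution w'" "w' 0 = (x0, v0)" using w unfolding Sol by blast
    have "z' t \<noteq> 0" if "0 \<le> t" for t
      using z(2) that by (simp add: z'(1) zero_prod_def)
    then have "z' t = w' t" if "0 \<le> t" for t
      using uniqueness[OF z'(2) w'(2)] z'(3) w'(3) that by simp
    then show ?thesis by (auto simp: z'(1) w'(1) restrict_def)
  qed
  \<comment> \<open>This solution shows that \<open>Sol\<close> is nonempty. Being made of Lipschitz
    arcs, it can also be glued to waiting and departing arcs if it reaches the origin.\<close>
  obtain g where g: "g 0 = (x0, v0)" "\<And>T. lipschitz_arc T g" using ex_arcs by blast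
  have g_Sol: "restrict g {0..} \<in> Sol" using g arcs_imp_solution Sol by auto
  have inf: "infinite Sol" if zero: "\<not> (\<exists>z\<in>Sol. \<forall>t\<ge>0. z t \<noteq> (0, 0))"
  proof -
    obtain T where "T \<ge> 0" "restrict g {0..} T = (0, 0)" using zero g_Sol by blast
    then have "T \<ge> 0" "g T = 0" by (simp_all add: zero_prod_def)
    then show ?thesis using infinitely_many_solutions[OF g(2)] g(1) Sol by simp
  qed
  have lim: "((\<lambda>t. \<bar>fst (z t)\<bar>) \<longlongrightarrow> dinf) at_top" if z: "z \<in> Sol" "\<forall>t\<ge>0. z t \<noteq> (0, 0)" for z
  proof -
    obtain z' where z': "z = restrict z' {0..}" "solution z'" using z(1) unfolding Sol by blast
    have "z' t \<noteq> 0" if "0 \<le> t" for t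
      using z(2) that by (simp add: z'(1) zero_prod_def)
    then have "((\<lambda>t. \<bar>fst (z' t)\<bar>) \<longlongrightarrow> dinf) at_top" by (rule distance_tendsto[OF z'(2)])
    then show ?thesis
      by (rule Lim_transform_eventually)
         (auto simp: z'(1) intro!: eventually_at_top_linorderI[of 0])
  qed
  \<comment> \<open>A unique solution must avoid the origin, since otherwise no solution does and
    \<open>Sol\<close> would be infinite. The converse is forward uniqueness.\<close>
  have "(\<exists>!z. z \<in> Sol) \<longleftrightarrow> (\<exists>z\<in>Sol. \<forall>t\<ge>0. z t \<noteq> (0, 0))"
  proof
    assume "\<exists>!z. z \<in> Sol"
    then obtain z where "Sol = {z}" by blast
    then show "\<exists>z\<in>Sol. \<forall>t\<ge>0. z t \<noteq> (0, 0)" using inf by fastforce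
  qed (use unique in blast)
  then show ?thesis using inf lim by blast
qed

end
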